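(* Let $\theta$ and $\tau$ be commuting invertible measure preserving transformations of a standard probability space $(\Omega,\mathbf B,\mathbb P)$ which generate an aperiodic $\mathbb Z^2$-action, and let $U$ and $V$ be their corresponding unitary operators on $L_2=L_2(\Omega,\mathbf B,\mathbb P)$, i.e. $Uf=f\circ\theta$ and $Vf=f\circ\tau$. Then there exists a function $g\in(I-U)L_2\cap(I-V)L_2$ which is not in $(I-U)(I-V)L_2$.
   Context: The $\mathbb Z^2$-action generated by commuting invertible probability preserving transformations $\theta,\tau$ is called aperiodic if for all $j,k\in\mathbb Z$ which are not both zero, $\mathbb P(\{x\in\Omega:\theta^j\tau^kx=x\})=0$. The space $L_2$ may be taken over the complex or over the real scalars; the assertion is made for either choice. *)

theory Defs
  imports "HOL-Probability.Probability"
begin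

text \<open>
  Isomorphism modulo null sets: a bimeasurable, measure preserving bijection between
  measurable sets of full measure.
\<close>

definition iso_mod0 :: "'a measure \<Rightarrow> 'b measure \<Rightarrow> bool" where
  "iso_mod0 M N \<longleftrightarrow>
    (\<exists>A B f g. A \<in> sets M \<and> B \<in> sets N \<and>
       emeasure M (space M - A) = 0 \<and> emeasure N (space N - B) = 0 \<and>
       f \<in> measurable (restrict_space M A) (restrict_space N B) \<and>
       g \<in> measurable (restrict_space N B) (restrict_space M A) \<and>
       (\<forall>x\<in>A. g (f x) = x) \<and> (\<forall>y\<in>B. f (g y) = y) \<and>
       distr (restrict_space M A) (restrict_space N B) f = restrict_space N B)"

text \<open>
  Every standard Borel space is isomorphic to a Borel subset of the real line, so the models
  below are, up to isomorphism, all Borel probability measures on Polish spaces; equivalently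
  (after completion) an interval with Lebesgue measure together with countably many atoms.
  Passing to completions on both sides admits the two usual conventions at once: probability
  measures on standard Borel spaces, and complete (Lebesgue-Rokhlin) probability spaces.
\<close>

definition standard_prob_space :: "'a measure \<Rightarrow> bool" where
  "standard_prob_space M \<longleftrightarrow>
    prob_space M \<and>
    (\<exists>N :: real measure. prob_space N \<and> sets N = sets borel \<and>
       iso_mod0 (completion M) (completion N))"

definition invertible_mpt :: "'a measure \<Rightarrow> ('a \<Rightarrow> 'a) \<Rightarrow> bool" where
  "invertible_mpt M T \<longleftrightarrow>
    bij_betw T (space M) (space M) \<and>
    T \<in> measurable M M \<and> inv_into (space M) T \<in> measurable M M \<and>
    distr M M T = M"

definition int_iterate :: "'a measure \<Rightarrow> ('a \<Rightarrow> 'a) \<Rightarrow> int \<Rightarrow> 'a \<Rightarrow> 'a" where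
  "int_iterate M T j =
    (if j \<ge> 0 then T ^^ nat j else inv_into (space M) T ^^ nat (- j))"

text \<open>
  The fixed point sets are measured in the completion, since they need not belong to
  \<^term>\<open>sets M\<close> itself, and \<^const>\<open>emeasure\<close> is 0 on every set that is not measurable.
\<close>

definition aperiodic_action :: "'a measure \<Rightarrow> ('a \<Rightarrow> 'a) \<Rightarrow> ('a \<Rightarrow> 'a) \<Rightarrow> bool" where
  "aperiodic_action M \<theta> \<tau> \<longleftrightarrow>
    (\<forall>j k. (j, k) \<noteq> (0, 0) \<longrightarrow>
       {x \<in> space M. int_iterate M \<theta> j (int_iterate M \<tau> k x) = x}
         \<in> null_sets (completion M))"

text \<open>
  Elements of $L_2$ are represented by functions; equality in $L_2$ is equality almost
  everywhere, and this is built into \<open>L2_range\<close>. The scalars are left polymorphic,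
  to be instantiated with \<^typ>\<open>real\<close> and \<^typ>\<open>complex\<close>.
\<close>

definition L2 :: "'a measure \<Rightarrow> ('a \<Rightarrow> 'b::real_normed_field) set" where
  "L2 M = {f \<in> borel_measurable M. integrable M (\<lambda>x. (norm (f x))\<^sup>2)}"

definition koopman :: "('a \<Rightarrow> 'a) \<Rightarrow> ('a \<Rightarrow> 'b::real_normed_field) \<Rightarrow> 'a \<Rightarrow> 'b" where
  "koopman T f = f \<circ> T"

definition id_minus ::
    "(('a \<Rightarrow> 'b::real_normed_field) \<Rightarrow> 'a \<Rightarrow> 'b) \<Rightarrow> ('a \<Rightarrow> 'b) \<Rightarrow> 'a \<Rightarrow> 'b" where
  "id_minus W f = (\<lambda>x. f x - W f x)"

definition L2_range ::
    "'a measure \<Rightarrow> (('a \<Rightarrow> 'b::real_normed_field) \<Rightarrow> 'a \<Rightarrow> 'b) \<Rightarrow> ('a \<Rightarrow> 'b) set" where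
  "L2_range M W = {g \<in> L2 M. \<exists>f\<in>L2 M. AE x in M. g x = W f x}"

end

theory Submission
  imports Defs
begin

text \<open>
  For every \<open>\<epsilon> > 0\<close> there is a bounded \<open>\<psi>\<close> such that
  \<open>f = (I - U) (I - V) \<psi>\<close> has norm 1 while \<open>(I - U) f\<close> and \<open>(I - V) f\<close> have norm
  at most \<open>\<epsilon>\<close>. By aperiodicity there is a set of positive measure (not
  necessarily large, so the Rokhlin lemma is not needed) whose translates over a square
  of \<open>\<int>\<^sup>2\<close> are disjoint, and \<open>\<psi>\<close> is a product of two triangle functions
  on this tower.

  A gliding hump then produces \<open>g\<close>: with such \<open>f\<^sub>k\<close> for rapidly decreasing
  \<open>\<epsilon>\<^sub>k\<close>, put \<open>g = (\<Sum>k. 3^k (I - U) (I - V) f\<^sub>k)\<close>. Both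
  \<open>(\<Sum>k. 3^k (I - V) f\<^sub>k)\<close> and \<open>(\<Sum>k. 3^k (I - U) f\<^sub>k)\<close> converge in \<open>L\<^sub>2\<close>.
  If \<open>g = (I - U) (I - V) h\<close>, then pairing with \<open>U V \<psi>\<^sub>n\<close> gives
  \<open>\<langle>h, f\<^sub>n\<rangle>\<close>, which is bounded in \<open>n\<close>, whereas the \<open>n\<close>-th term of the series
  contributes \<open>3^n\<close> and the other terms at most \<open>3^n / 2 + O(1)\<close>.
\<close>

section \<open>Separating points of a standard space\<close>

text \<open>The isomorphism with a real model is injective on a set of full measure but measurable
  only for the completion. An almost everywhere equal function that is measurable for
  \<open>M\<close> stays injective on the points where the two agree.\<close>

lemma standard_prob_space_injection:
  assumes "standard_prob_space M"
  obtains e :: "'a \<Rightarrow> real" and A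
  where "e \<in> borel_measurable M" "AE x in M. x \<in> A" "inj_on e A"
proof -
  from assms obtain N :: "real measure" and A B f g where
    N: "sets N = sets borel" and A: "A \<in> sets (completion M)"
    and A0: "emeasure (completion M) (space (completion M) - A) = 0"
    and f: "f \<in> measurable (restrict_space (completion M) A) (restrict_space (completion N) B)"
    and gf: "\<forall>x\<in>A. g (f x) = x"
    unfolding standard_prob_space_def iso_mod0_def by blast
  have "(\<lambda>x. x) \<in> measurable N borel"
    using N by (simp cong: measurable_cong_sets)
  moreover have "f \<in> measurable (restrict_space (completion M) A) (completion N)"
    using f by (simp add: measurable_restrict_space2_iff)
  ultimately have "f \<in> borel_measurable (restrict_space (completion M) A)"
    using measurable_compose[OF _ measurable_completion] by blast
  then have "(\<lambda>x. indicat_real A x *\<^sub>R f x) \<in> borel_measurable (completion M)"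
    using A by (subst (asm) borel_measurable_restrict_space_iff) auto
  from completion_ex_borel_measurable_real[OF this]
  obtain e where e: "e \<in> borel_measurable M" "AE x in M. indicat_real A x *\<^sub>R f x = e x"
    by blast
  have "space (completion M) - A \<in> null_sets (completion M)"
    using A A0 by auto
  then have "AE x in completion M. x \<in> A"
    by (intro AE_I'[where N = "space (completion M) - A"]) auto
  then have "AE x in M. x \<in> A"
    by (simp add: AE_completion_iff)
  with e(2) have "AE x in M. x \<in> {x \<in> A. f x = e x}"
    by eventually_elim simp
  moreover have "inj_on e {x \<in> A. f x = e x}"
    using gf by (intro inj_onI) (metis (mono_tags, lifting) mem_Collect_eq)
  ultimately show thesis
    using e(1) that by blast
qed

text \<open>Finitely many distinct reals have a positive minimal gap, and a grid of smaller mesh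
  separates them. Dyadic meshes keep the family of grids countable.\<close>

lemma exists_pow2_floor_inj_on:
  fixes v :: "'i \<Rightarrow> real"
  assumes "finite P" "inj_on v P"
  shows "\<exists>k::nat. inj_on (\<lambda>p. \<lfloor>2 ^ k * v p\<rfloor>) P"
proof -
  have "\<exists>d>0. \<forall>p\<in>P. \<forall>q\<in>P. p \<noteq> q \<longrightarrow> d \<le> \<bar>v p - v q\<bar>"
  proof -
    \<comment> \<open>Inserting 1 keeps \<open>D\<close> nonempty when \<open>P\<close> has at most
      one point, so that \<open>Min D\<close> makes sense.\<close>
    define D where "D = insert 1 ((\<lambda>(p, q). \<bar>v p - v q\<bar>) ` {(p, q) \<in> P \<times> P. p \<noteq> q})"
    have "finite {(p, q) \<in> P \<times> P. p \<noteq> q}"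
      by (rule finite_subset[of _ "P \<times> P"]) (use assms in auto)
    then have D: "finite D" "D \<noteq> {}"
      by (auto simp: D_def)
    have "\<forall>d\<in>D. 0 < d"
      using assms(2) by (auto simp: D_def inj_on_def)
    then have "0 < Min D"
      using D by simp
    moreover have "\<forall>p\<in>P. \<forall>q\<in>P. p \<noteq> q \<longrightarrow> Min D \<le> \<bar>v p - v q\<bar>"
      using D by (auto simp: D_def intro!: Min_le)
    ultimately show ?thesis by blast
  qed
  then obtain d where d: "d > 0" "\<And>p q. p \<in> P \<Longrightarrow> q \<in> P \<Longrightarrow> p \<noteq> q \<Longrightarrow> d \<le> \<bar>v p - v q\<bar>"
    by blast
  obtain k :: nat where k: "1 / d < 2 ^ k"
    using real_arch_pow[of 2 "1/d"] by auto
  have "inj_on (\<lambda>p. \<lfloor>2 ^ k * v p\<rfloor>) P"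
  proof (rule inj_onI, rule ccontr)
    fix p q assume pq: "p \<in> P" "q \<in> P" "\<lfloor>2 ^ k * v p\<rfloor> = \<lfloor>2 ^ k * v q\<rfloor>" "p \<noteq> q"
    have "1 < 2 ^ k * d"
      using k d(1) by (simp add: field_simps)
    also have "\<dots> \<le> 2 ^ k * \<bar>v p - v q\<bar>"
      using d(2)[OF pq(1,2,4)] by simp
    also have "\<dots> = \<bar>2 ^ k * v p - 2 ^ k * v q\<bar>"
      by (simp add: abs_mult flip: right_diff_distrib)
    also have "\<dots> < 1"
      using pq(3) by linarith
    finally show False .
  qed
  then show ?thesis ..
qed

text \<open>The \<open>y p\<close> model the values at one point of indicators of pairwise disjoint
  sets: idempotent and mutually orthogonal, they leave only the diagonal of the double sum.\<close>

lemma square_sum_disjoint: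
  fixes c y :: "'i \<Rightarrow> real"
  assumes "finite P" "\<And>p. p \<in> P \<Longrightarrow> y p * y p = y p"
    and "\<And>p q. p \<in> P \<Longrightarrow> q \<in> P \<Longrightarrow> p \<noteq> q \<Longrightarrow> y p * y q = 0"
  shows "(\<Sum>p\<in>P. c p * y p)\<^sup>2 = (\<Sum>p\<in>P. (c p)\<^sup>2 * y p)"
proof -
  have "(\<Sum>p\<in>P. c p * y p)\<^sup>2 = (\<Sum>p\<in>P. \<Sum>q\<in>P. (c p * c q) * (y p * y q))"
    by (simp add: power2_eq_square sum_product mult_ac)
  also have "\<dots> = (\<Sum>p\<in>P. \<Sum>q\<in>P. if p = q then (c p)\<^sup>2 * y p else 0)"
    by (intro sum.cong refl) (auto simp: assms(2,3) power2_eq_square)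
  also have "\<dots> = (\<Sum>p\<in>P. (c p)\<^sup>2 * y p)"
    using assms(1) by simp
  finally show ?thesis .
qed

section \<open>Square integrable functions\<close>

text \<open>If \<open>s\<^sup>2\<close> is the weighted sum, then
  \<open>\<bar>y k\<bar> \<le> s / 2 ^ k\<close>; the geometric series adds up to
  \<open>2 * s\<close>, whence the factor 4.\<close>

lemma summable_geometric_weight:
  fixes y :: "nat \<Rightarrow> real"
  assumes S: "summable (\<lambda>k. 4 ^ k * (y k)\<^sup>2)"
  shows "summable (\<lambda>k. \<bar>y k\<bar>)" "(\<Sum>k. y k)\<^sup>2 \<le> 4 * (\<Sum>k. 4 ^ k * (y k)\<^sup>2)"
proof -
  define s where "s = sqrt (\<Sum>k. 4 ^ k * (y k)\<^sup>2)"
  have s0: "0 \<le> (\<Sum>k. 4 ^ k * (y k)\<^sup>2)"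
    by (intro suminf_nonneg S) auto
  have y: "\<bar>y k\<bar> \<le> s * (1/2) ^ k" for k
  proof -
    have "(2 ^ k * \<bar>y k\<bar>)\<^sup>2 = 4 ^ k * (y k)\<^sup>2"
      by (simp add: power2_eq_square mult_ac abs_mult_self_eq flip: power_mult_distrib mult.assoc)
    also have "\<dots> \<le> (\<Sum>k. 4 ^ k * (y k)\<^sup>2)"
      using sum_le_suminf[OF S, of "{k}"] by simp
    finally have "2 ^ k * \<bar>y k\<bar> \<le> s"
      unfolding s_def by (rule real_le_rsqrt)
    then show ?thesis
      by (simp add: field_simps power_one_over)
  qed
  have g: "(\<lambda>k. s * (1/2) ^ k) sums (s * 2)"
    using geometric_sums[of "1/2::real"] by (intro sums_mult) simp
  show abs: "summable (\<lambda>k. \<bar>y k\<bar>)"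
    by (rule summable_comparison_test'[OF sums_summable[OF g], of 0]) (use y in auto)
  have "\<bar>\<Sum>k. y k\<bar> \<le> (\<Sum>k. \<bar>y k\<bar>)"
    by (rule summable_rabs[OF abs])
  also have "\<dots> \<le> s * 2"
    using suminf_le[OF y abs sums_summable[OF g]] sums_unique[OF g] by simp
  finally have "\<bar>\<Sum>k. y k\<bar>\<^sup>2 \<le> (s * 2)\<^sup>2"
    by (intro power_mono) auto
  then show "(\<Sum>k. y k)\<^sup>2 \<le> 4 * (\<Sum>k. 4 ^ k * (y k)\<^sup>2)"
    using s0 by (simp add: power_mult_distrib s_def)
qed

context prob_space
begin

lemma integrable_bounded:
  fixes f :: "'a \<Rightarrow> real"
  assumes "f \<in> borel_measurable M" "\<And>x. x \<in> space M \<Longrightarrow> \<bar>f x\<bar> \<le> K"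
  shows "integrable M f"
  using assms by (intro integrable_const_bound[where B = K]) (auto intro: AE_I2)

lemma integrable_mult_bounded:
  fixes f g :: "'a \<Rightarrow> real"
  assumes f: "integrable M f" and g: "g \<in> borel_measurable M" "\<And>x. \<bar>g x\<bar> \<le> K"
  shows "integrable M (\<lambda>x. f x * g x)"
proof (rule Bochner_Integration.integrable_bound)
  show "integrable M (\<lambda>x. K * f x)" using f by simp
  show "(\<lambda>x. f x * g x) \<in> borel_measurable M" using f g by measurable
  have "\<bar>f x\<bar> * \<bar>g x\<bar> \<le> \<bar>K * f x\<bar>" for x
    using mult_left_mono[OF g(2)[of x], of "\<bar>f x\<bar>"] g(2)[of x] by (simp add: abs_mult mult_ac)
  then show "AE x in M. norm (f x * g x) \<le> norm (K * f x)"
    by (simp add: abs_mult)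
qed

text \<open>Integrating \<open>\<bar>y x\<bar> \<le> ((y x)\<^sup>2 / d + d) / 2\<close> replaces
  Cauchy-Schwarz against the constant 1.\<close>

lemma integral_abs_le_of_square:
  fixes y :: "'a \<Rightarrow> real"
  assumes y: "y \<in> borel_measurable M" "integrable M (\<lambda>x. (y x)\<^sup>2)"
    and d: "0 < d" "(\<integral>x. (y x)\<^sup>2 \<partial>M) \<le> d\<^sup>2"
  shows "(\<integral>x. \<bar>y x\<bar> \<partial>M) \<le> d"
proof -
  have "(\<integral>x. \<bar>y x\<bar> \<partial>M) \<le> (\<integral>x. ((y x)\<^sup>2 / d + d) / 2 \<partial>M)"
  proof (rule integral_mono)
    show "integrable M (\<lambda>x. \<bar>y x\<bar>)"
      using square_integrable_imp_integrable[OF y] by simp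
    show "integrable M (\<lambda>x. ((y x)\<^sup>2 / d + d) / 2)"
      using y by simp
    show "\<bar>y x\<bar> \<le> ((y x)\<^sup>2 / d + d) / 2" for x
      using d(1) sum_squares_bound[of "\<bar>y x\<bar>" d] by (simp add: field_simps power2_eq_square)
  qed
  also have "\<dots> = ((\<integral>x. (y x)\<^sup>2 \<partial>M) / d + d) / 2"
    using y by (simp add: prob_space)
  also have "\<dots> \<le> (d\<^sup>2 / d + d) / 2"
    using d by (intro divide_right_mono add_right_mono) auto
  also have "\<dots> = d"
    using d by (simp add: power2_eq_square)
  finally show ?thesis .
qed

text \<open>Since 16 exceeds the weight 4, the series of \<open>4 ^ k * (y k x)\<^sup>2\<close> has
  finite integral. It therefore converges almost everywhere and, up to the factor 4, dominates the
  square of the sum. Termwise pairing rests on the L1 bounds \<open>(1/4) ^ k\<close>.\<close>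

lemma L2_series:
  fixes y :: "nat \<Rightarrow> 'a \<Rightarrow> real"
  assumes y [measurable]: "\<And>k. y k \<in> borel_measurable M"
    and int: "\<And>k. integrable M (\<lambda>x. (y k x)\<^sup>2)"
    and le: "\<And>k. (\<integral>x. (y k x)\<^sup>2 \<partial>M) \<le> (1/16) ^ k"
  shows "AE x in M. summable (\<lambda>k. \<bar>y k x\<bar>)"
    and "integrable M (\<lambda>x. (\<Sum>k. y k x)\<^sup>2)"
    and "\<lbrakk>\<eta> \<in> borel_measurable M; \<And>x. \<bar>\<eta> x\<bar> \<le> K\<rbrakk> \<Longrightarrow>
          (\<lambda>k. \<integral>x. y k x * \<eta> x \<partial>M) sums (\<integral>x. (\<Sum>k. y k x) * \<eta> x \<partial>M)"
proof -
  have w: "(\<integral>x. 4 ^ k * (y k x)\<^sup>2 \<partial>M) \<le> (1/4) ^ k" for k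
  proof -
    have "(\<integral>x. 4 ^ k * (y k x)\<^sup>2 \<partial>M) = 4 ^ k * (\<integral>x. (y k x)\<^sup>2 \<partial>M)"
      by simp
    also have "\<dots> \<le> 4 ^ k * (1/16) ^ k"
      by (intro mult_left_mono le) auto
    finally show ?thesis
      by (simp flip: power_mult_distrib)
  qed
  have quarter: "summable (\<lambda>k. (1/4) ^ k :: real)"
    by (rule summable_geometric) simp
  have "(\<integral>\<^sup>+x. (\<Sum>k. ennreal (4 ^ k * (y k x)\<^sup>2)) \<partial>M)
      = (\<Sum>k. ennreal (\<integral>x. 4 ^ k * (y k x)\<^sup>2 \<partial>M))"
  proof -
    have "(\<integral>\<^sup>+x. ennreal (4 ^ k * (y k x)\<^sup>2) \<partial>M) = ennreal (\<integral>x. 4 ^ k * (y k x)\<^sup>2 \<partial>M)" for k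
      using int by (intro nn_integral_eq_integral) auto
    then show ?thesis
      by (subst nn_integral_suminf) auto
  qed
  also have "\<dots> \<le> (\<Sum>k. ennreal ((1/4) ^ k))"
    using w by (intro suminf_le) (auto intro: ennreal_leI)
  also have "\<dots> < \<infinity>"
    using quarter by (simp add: ennreal_suminf_neq_top less_top[symmetric])
  finally have "AE x in M. (\<Sum>k. ennreal (4 ^ k * (y k x)\<^sup>2)) \<noteq> \<infinity>"
    by (intro nn_integral_PInf_AE) auto
  then have S: "AE x in M. summable (\<lambda>k. 4 ^ k * (y k x)\<^sup>2)"
    by eventually_elim (auto intro: summable_suminf_not_top)
  then show abs: "AE x in M. summable (\<lambda>k. \<bar>y k x\<bar>)"
    by eventually_elim (rule summable_geometric_weight)
  have "integrable M (\<lambda>x. \<Sum>k. 4 ^ k * (y k x)\<^sup>2)"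
  proof (rule integrable_suminf)
    show "AE x in M. summable (\<lambda>k. norm (4 ^ k * (y k x)\<^sup>2))"
      using S by simp
    show "summable (\<lambda>k. \<integral>x. norm (4 ^ k * (y k x)\<^sup>2) \<partial>M)"
      using w by (intro summable_comparison_test'[OF quarter, of 0]) simp
  qed (use int in simp)
  then have "integrable M (\<lambda>x. 4 * (\<Sum>k. 4 ^ k * (y k x)\<^sup>2))"
    by simp
  then show "integrable M (\<lambda>x. (\<Sum>k. y k x)\<^sup>2)"
  proof (rule Bochner_Integration.integrable_bound)
    show "AE x in M. norm ((\<Sum>k. y k x)\<^sup>2) \<le> norm (4 * (\<Sum>k. 4 ^ k * (y k x)\<^sup>2))"
      using S
    proof eventually_elim
      case (elim x)
      from summable_geometric_weight(2)[OF this] show ?case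
        by (simp only: real_norm_def abs_power2)
    qed
  qed measurable
  show "(\<lambda>k. \<integral>x. y k x * \<eta> x \<partial>M) sums (\<integral>x. (\<Sum>k. y k x) * \<eta> x \<partial>M)"
    if \<eta> [measurable]: "\<eta> \<in> borel_measurable M" and K: "\<And>x. \<bar>\<eta> x\<bar> \<le> K"
  proof -
    have L1: "(\<integral>x. \<bar>y k x\<bar> \<partial>M) \<le> (1/4) ^ k" for k
      using le[of k] by (intro integral_abs_le_of_square y int) (auto simp: power2_eq_square simp flip: power_mult_distrib)
    have iy: "integrable M (y k)" for k
      by (rule square_integrable_imp_integrable[OF y int])
    have K0: "0 \<le> K"
      using K[of undefined] by simp
    have bound: "\<bar>y k x * \<eta> x\<bar> \<le> K * \<bar>y k x\<bar>" for k x
      using mult_left_mono[OF K[of x], of "\<bar>y k x\<bar>"] by (simp add: abs_mult mult_ac)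
    have "(\<lambda>k. \<integral>x. y k x * \<eta> x \<partial>M) sums (\<integral>x. (\<Sum>k. y k x * \<eta> x) \<partial>M)"
    proof (rule sums_integral)
      show "integrable M (\<lambda>x. y k x * \<eta> x)" for k
        by (rule integrable_mult_bounded[OF iy \<eta> K])
      show "AE x in M. summable (\<lambda>k. norm (y k x * \<eta> x))"
        using abs
      proof eventually_elim
        case (elim x)
        show ?case
          using bound by (intro summable_comparison_test'[OF summable_mult[OF elim, of K], of 0]) simp
      qed
      have "(\<integral>x. \<bar>y k x * \<eta> x\<bar> \<partial>M) \<le> K * (1/4) ^ k" for k
      proof -
        have "(\<integral>x. \<bar>y k x * \<eta> x\<bar> \<partial>M) \<le> (\<integral>x. K * \<bar>y k x\<bar> \<partial>M)"
          using bound iy integrable_mult_bounded[OF iy \<eta> K]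
          by (intro integral_mono) auto
        also have "\<dots> \<le> K * (1/4) ^ k"
          using L1 K0 by (simp add: mult_left_mono)
        finally show ?thesis .
      qed
      then show "summable (\<lambda>k. \<integral>x. norm (y k x * \<eta> x) \<partial>M)"
        by (intro summable_comparison_test'[OF summable_mult[OF quarter, of K], of 0]) simp
    qed
    also have "(\<integral>x. (\<Sum>k. y k x * \<eta> x) \<partial>M) = (\<integral>x. (\<Sum>k. y k x) * \<eta> x \<partial>M)"
    proof (rule integral_cong_AE)
      show "AE x in M. (\<Sum>k. y k x * \<eta> x) = (\<Sum>k. y k x) * \<eta> x"
        using abs by eventually_elim (auto intro: suminf_mult2[symmetric] summable_rabs_cancel)
    qed measurable
    finally show ?thesis .
  qed
qed

end

text \<open>The arithmetic-geometric mean inequality in place of Cauchy-Schwarz. It still gives the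
  sharp bound 1 for two functions of norm 1.\<close>

lemma integral_mult_le:
  fixes f g :: "'a \<Rightarrow> real"
  assumes [measurable]: "f \<in> borel_measurable M" "g \<in> borel_measurable M"
    and "integrable M (\<lambda>x. (f x)\<^sup>2)" "integrable M (\<lambda>x. (g x)\<^sup>2)"
  shows "\<bar>\<integral>x. f x * g x \<partial>M\<bar> \<le> ((\<integral>x. (f x)\<^sup>2 \<partial>M) + (\<integral>x. (g x)\<^sup>2 \<partial>M)) / 2"
proof -
  have i: "integrable M (\<lambda>x. ((f x)\<^sup>2 + (g x)\<^sup>2) / 2)"
    using assms by simp
  have le: "\<bar>f x * g x\<bar> \<le> ((f x)\<^sup>2 + (g x)\<^sup>2) / 2" for x
    using sum_squares_bound[of "\<bar>f x\<bar>" "\<bar>g x\<bar>"] by (simp add: abs_mult)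
  have fg: "integrable M (\<lambda>x. f x * g x)"
    by (rule Bochner_Integration.integrable_bound[OF i]) (use le in auto)
  have "\<bar>\<integral>x. f x * g x \<partial>M\<bar> \<le> (\<integral>x. \<bar>f x * g x\<bar> \<partial>M)"
    by (rule integral_abs_bound)
  also have "\<dots> \<le> (\<integral>x. ((f x)\<^sup>2 + (g x)\<^sup>2) / 2 \<partial>M)"
    using fg i le by (intro integral_mono) auto
  finally show ?thesis
    using assms by simp
qed

lemma L2_diff:
  fixes f g :: "'a \<Rightarrow> real"
  assumes "f \<in> L2 M" "g \<in> L2 M"
  shows "(\<lambda>x. f x - g x) \<in> L2 M"
proof -
  have [measurable]: "f \<in> borel_measurable M" "g \<in> borel_measurable M"
    and i: "integrable M (\<lambda>x. 2 * (f x)\<^sup>2 + 2 * (g x)\<^sup>2)"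
    using assms by (auto simp: L2_def)
  have "(f x - g x)\<^sup>2 \<le> 2 * (f x)\<^sup>2 + 2 * (g x)\<^sup>2" for x
    using zero_le_power2[of "f x + g x"] by (simp add: power2_eq_square algebra_simps)
  then have "integrable M (\<lambda>x. (f x - g x)\<^sup>2)"
    by (intro Bochner_Integration.integrable_bound[OF i]) auto
  then show ?thesis
    by (simp add: L2_def)
qed

lemma L2_of_real: "f \<in> L2 M \<Longrightarrow> (\<lambda>x. complex_of_real (f x)) \<in> L2 M"
  by (auto simp: L2_def)

lemma L2_Re:
  assumes "f \<in> L2 M"
  shows "(\<lambda>x. Re (f x)) \<in> L2 M"
proof -
  have [measurable]: "f \<in> borel_measurable M" and i: "integrable M (\<lambda>x. (norm (f x))\<^sup>2)"
    using assms by (auto simp: L2_def)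
  have "(Re z)\<^sup>2 \<le> (cmod z)\<^sup>2" for z
    using power_mono[OF abs_Re_le_cmod, of z 2] by simp
  then have "integrable M (\<lambda>x. (Re (f x))\<^sup>2)"
    by (intro Bochner_Integration.integrable_bound[OF i]) auto
  then show ?thesis
    by (simp add: L2_def)
qed

section \<open>Difference sequences\<close>

text \<open>The sequence is continued by 0 to negative indices, so the jump from 0 to
  \<open>u 0\<close> counts as a difference.\<close>

definition bdiff :: "(nat \<Rightarrow> real) \<Rightarrow> nat \<Rightarrow> real" where
  "bdiff u i = u i - (if i = 0 then 0 else u (i - 1))"

text \<open>Summation by parts; \<open>u n = 0\<close> removes the boundary term with
  \<open>g (Suc n)\<close>.\<close>

lemma sum_bdiff:
  assumes "u n = 0"
  shows "(\<Sum>i\<le>n. bdiff u i * g i) = (\<Sum>i\<le>n. u i * g i) - (\<Sum>i\<le>n. u i * g (Suc i))"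
proof -
  have "(\<Sum>i\<le>n. (if i = 0 then 0 else u (i - 1)) * g i) = (\<Sum>i<n. u i * g (Suc i))"
    by (subst sum.atMost_shift) simp
  also have "\<dots> = (\<Sum>i\<le>n. u i * g (Suc i))"
    using assms by (simp add: lessThan_Suc_atMost[symmetric])
  finally show ?thesis
    by (simp add: bdiff_def left_diff_distrib sum_subtractf)
qed

text \<open>
  For large \<open>m\<close> the second difference of this profile is small in the square norm
  relative to the first one.
\<close>

definition triangle :: "nat \<Rightarrow> nat \<Rightarrow> real" where
  "triangle m i = real (min (Suc i) (2 * m - 1 - i))"

lemma triangle_end: "triangle m (2 * m) = 0"
  by (simp add: triangle_def)

lemma bdiff_triangle:
  assumes "m > 0"
  shows "bdiff (triangle m) i = (if i < m then 1 else if i < 2 * m then -1 else 0)"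
  using assms by (auto simp: bdiff_def triangle_def min_def of_nat_diff)

lemma sum_bdiff_triangle_square:
  assumes "m > 0"
  shows "(\<Sum>i\<le>2 * m. (bdiff (triangle m) i)\<^sup>2) = 2 * real m"
proof -
  have "(bdiff (triangle m) i)\<^sup>2 = 1" if "i < 2 * m" for i
    using that by (simp add: bdiff_triangle assms)
  moreover have "bdiff (triangle m) (2 * m) = 0"
    by (simp add: bdiff_triangle assms)
  ultimately show ?thesis
    unfolding lessThan_Suc_atMost[symmetric] sum.lessThan_Suc by simp
qed

text \<open>The first difference is a block of ones followed by a block of minus ones, so the second
  is 1, -2, 1 at 0, \<open>m\<close>, \<open>2 * m\<close> and 0 elsewhere. Unlike the sum for the
  first difference, this one does not grow with \<open>m\<close>.\<close>

lemma sum_bdiff_bdiff_triangle_square: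
  assumes "m > 0"
  shows "(\<Sum>i\<le>2 * m. (bdiff (bdiff (triangle m)) i)\<^sup>2) = 6"
proof -
  have "(bdiff (bdiff (triangle m)) i)\<^sup>2
      = (if i = 0 then 1 else 0) + (if i = m then 4 else 0) + (if i = 2 * m then 1 else 0)" for i
    unfolding bdiff_def[of "bdiff (triangle m)"] bdiff_triangle[OF assms] using assms by auto
  then show ?thesis
    by (simp add: sum.distrib)
qed

section \<open>Towers of commuting transformations\<close>

lemma measurable_funpow_self:
  "T \<in> measurable M M \<Longrightarrow> T ^^ n \<in> measurable M M"
  by (induction n) (auto intro: measurable_comp)

lemma funpow_distr:
  assumes "T \<in> measurable M M" "distr M M T = M"
  shows "distr M M (T ^^ n) = M"
proof (induction n)
  case 0
  then show ?case by (simp add: distr_id id_def)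
next
  case (Suc n)
  have "distr M M (T ^^ Suc n) = distr (distr M M (T ^^ n)) M T"
    using assms(1) by (subst distr_distr) (auto intro: measurable_funpow_self)
  with Suc assms(2) show ?case by (simp only:)
qed

locale commuting_mpt = prob_space M for M :: "'a measure" +
  fixes \<theta> \<tau> :: "'a \<Rightarrow> 'a"
  assumes measurable_theta [measurable]: "\<theta> \<in> measurable M M"
    and measurable_tau [measurable]: "\<tau> \<in> measurable M M"
    and distr_theta: "distr M M \<theta> = M"
    and distr_tau: "distr M M \<tau> = M"
    and commute: "x \<in> space M \<Longrightarrow> \<theta> (\<tau> x) = \<tau> (\<theta> x)"
begin

definition act :: "nat \<times> nat \<Rightarrow> 'a \<Rightarrow> 'a" where
  "act p x = (\<theta> ^^ fst p) ((\<tau> ^^ snd p) x)"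

lemma theta_space [simp]: "x \<in> space M \<Longrightarrow> \<theta> x \<in> space M"
  and tau_space [simp]: "x \<in> space M \<Longrightarrow> \<tau> x \<in> space M"
  using measurable_space[OF measurable_theta] measurable_space[OF measurable_tau] by auto

lemma funpow_theta_space [simp]: "x \<in> space M \<Longrightarrow> (\<theta> ^^ n) x \<in> space M"
  and funpow_tau_space [simp]: "x \<in> space M \<Longrightarrow> (\<tau> ^^ n) x \<in> space M"
  by (induction n) auto

lemma act_eq_comp: "act p = \<theta> ^^ fst p \<circ> \<tau> ^^ snd p"
  by (auto simp: act_def)

lemma measurable_act [measurable]: "act p \<in> measurable M M"
  unfolding act_eq_comp
  by (rule measurable_comp[where N = M]; intro measurable_funpow_self measurable_theta measurable_tau)

lemma distr_act: "distr M M (act p) = M"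
proof -
  have "distr M M (act p) = distr (distr M M (\<tau> ^^ snd p)) M (\<theta> ^^ fst p)"
    by (subst distr_distr) (auto simp: act_eq_comp intro: measurable_funpow_self)
  then show ?thesis
    by (simp add: funpow_distr distr_theta distr_tau)
qed

lemma AE_comp:
  assumes "T \<in> measurable M M" "distr M M T = M" "AE x in M. Q x"
  shows "AE x in M. Q (T x)"
  by (rule AE_distrD[OF assms(1), where P = Q]) (simp only: assms(2,3))

lemma funpow_commute1: "x \<in> space M \<Longrightarrow> (\<theta> ^^ i) (\<tau> x) = \<tau> ((\<theta> ^^ i) x)"
  by (induction i) (auto simp: commute)

lemma funpow_commute: "x \<in> space M \<Longrightarrow> (\<theta> ^^ i) ((\<tau> ^^ j) x) = (\<tau> ^^ j) ((\<theta> ^^ i) x)"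
  by (induction j) (auto simp: funpow_commute1)

lemma act_add: "x \<in> space M \<Longrightarrow> act (i + k, j + l) x = act (i, j) (act (k, l) x)"
  by (simp add: act_def funpow_add funpow_commute)

text \<open>
  A level set of the vector of grid cells visited by the points \<open>act p x\<close> is a tower
  base as soon as the cells are distinct: if \<open>act p x\<close> and \<open>act q x\<close> both lie in it,
  moving both forward to their coordinatewise maximum puts one point into two different cells.
\<close>

lemma tower_exists:
  fixes e :: "'a \<Rightarrow> real"
  assumes e [measurable]: "e \<in> borel_measurable M"
    and inj: "AE x in M. inj_on (\<lambda>p. e (act p x)) ({..n} \<times> {..n})"
  obtains B where "B \<in> sets M" "prob B > 0"
    and "\<And>p q x. \<lbrakk>p \<in> {..n} \<times> {..n}; q \<in> {..n} \<times> {..n}; p \<noteq> q; x \<in> space M\<rbrakk>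
           \<Longrightarrow> \<not> (act p x \<in> B \<and> act q x \<in> B)"
proof -
  define P where "P = {..n} \<times> {..n}"
  have P: "finite P" by (simp add: P_def)
  define C where "C k m = {x \<in> space M. \<forall>p\<in>P. \<lfloor>2 ^ k * e (act p x)\<rfloor> = m p}"
    for k :: nat and m :: "nat \<times> nat \<Rightarrow> int"
  have C_sets: "C k m \<in> sets M" for k m
    unfolding C_def using P by measurable
  \<comment> \<open>Patterns are taken extensional on the finite set \<open>P\<close>, so there are
    only countably many.\<close>
  define R where "R = (UNIV :: nat set) \<times> {m \<in> Pi\<^sub>E P (\<lambda>_. UNIV :: int set). inj_on m P}"
  have "countable (Pi\<^sub>E P (\<lambda>_. UNIV :: int set))"
    using P by (intro countable_PiE) auto
  then have R: "countable R"
    unfolding R_def by (intro countable_SIGMA) (auto intro: countable_subset)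
  \<comment> \<open>The sets for these pairs cover almost every point, so they cannot all be
    null.\<close>
  have "\<exists>(k, m)\<in>R. C k m \<notin> null_sets M"
  proof (rule ccontr)
    assume "\<not> ?thesis"
    then have "(\<Union>(k, m)\<in>R. C k m) \<in> null_sets M"
      by (intro null_sets_UN'[OF R]) auto
    then have "AE x in M. x \<notin> (\<Union>(k, m)\<in>R. C k m)"
      by (rule AE_not_in)
    with inj have "AE x in M. False"
      using AE_space
    proof eventually_elim
      case (elim x)
      from elim(1) obtain k where k: "inj_on (\<lambda>p. \<lfloor>2 ^ k * e (act p x)\<rfloor>) P"
        using exists_pow2_floor_inj_on[OF P] by (auto simp: P_def)
      define m where "m = restrict (\<lambda>p. \<lfloor>2 ^ k * e (act p x)\<rfloor>) P"
      have "(k, m) \<in> R"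
        using k by (auto simp: R_def m_def inj_on_def)
      moreover have "x \<in> C k m"
        using elim(3) by (simp add: C_def m_def)
      ultimately show ?case using elim(2) by blast
    qed
    then show False by (simp add: AE_False emeasure_space_1)
  qed
  then obtain k m where m: "inj_on m P" and C: "C k m \<notin> null_sets M"
    by (auto simp: R_def)
  have pos: "prob (C k m) > 0"
    using C C_sets[of k m] by (simp add: null_sets_def emeasure_eq_measure zero_less_measure_iff)
  have "\<not> (act p x \<in> C k m \<and> act q x \<in> C k m)"
    if pq: "p \<in> P" "q \<in> P" "p \<noteq> q" and x: "x \<in> space M" for p q x
  proof
    assume a: "act p x \<in> C k m \<and> act q x \<in> C k m"
    obtain i j i' j' where ij: "p = (i, j)" "q = (i', j')"
      by fastforce
    \<comment> \<open>Subtracting from the coordinatewise maximum keeps \<open>r\<close> and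
      \<open>s\<close> in the square, and \<open>r = s\<close> would force
      \<open>p = q\<close>.\<close>
    define r where "r = (max i i' - i, max j j' - j)"
    define s where "s = (max i i' - i', max j j' - j')"
    have "act r (act p x) = act (max i i', max j j') x"
      by (simp add: r_def ij act_add[symmetric] x)
    moreover have "act s (act q x) = act (max i i', max j j') x"
      by (simp add: s_def ij act_add[symmetric] x)
    moreover have rs: "r \<in> P" "s \<in> P"
      using pq by (auto simp: P_def r_def s_def ij)
    moreover have "m r = \<lfloor>2 ^ k * e (act r (act p x))\<rfloor>" "m s = \<lfloor>2 ^ k * e (act s (act q x))\<rfloor>"
      using a rs unfolding C_def by fastforce+
    ultimately have "m r = m s"
      by simp
    then have "r = s"
      using m rs by (auto simp: inj_on_def)
    then show False
      using pq(3) by (auto simp: r_def s_def ij)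
  qed
  with C_sets pos that show thesis
    unfolding P_def by blast
qed

section \<open>Tower functions and their differences\<close>

definition mixed_diff :: "('a \<Rightarrow> real) \<Rightarrow> 'a \<Rightarrow> real" where
  "mixed_diff f x = f x - f (\<theta> x) - f (\<tau> x) + f (\<theta> (\<tau> x))"

text \<open>Product coefficients spread over the preimages of \<open>B\<close>. With preimages
  rather than images, composition with \<open>\<theta>\<close> or \<open>\<tau>\<close> becomes a
  shift of one index.\<close>

definition tower_fun :: "nat \<Rightarrow> 'a set \<Rightarrow> (nat \<Rightarrow> real) \<Rightarrow> (nat \<Rightarrow> real) \<Rightarrow> 'a \<Rightarrow> real" where
  "tower_fun n B u v x = (\<Sum>i\<le>n. \<Sum>j\<le>n. u i * v j * indicat_real B (act (i, j) x))"

lemma measurable_tower_fun [measurable]: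
  "B \<in> sets M \<Longrightarrow> tower_fun n B u v \<in> borel_measurable M"
  unfolding tower_fun_def
  by (intro borel_measurable_sum borel_measurable_times borel_measurable_const
      measurable_compose[OF measurable_act borel_measurable_indicator])

lemma abs_tower_fun_le: "\<bar>tower_fun n B u v x\<bar> \<le> (\<Sum>i\<le>n. \<Sum>j\<le>n. \<bar>u i * v j\<bar>)"
  unfolding tower_fun_def
  by (intro order.trans[OF sum_abs] sum_mono) (auto simp: indicator_def)

text \<open>Composition with \<open>\<theta>\<close> replaces \<open>i\<close> by
  \<open>Suc i\<close>. Summing over \<open>j\<close> first leaves a one-dimensional sum, where
  \<open>sum_bdiff\<close> turns the shift into a difference of \<open>u\<close>.\<close>

lemma tower_fun_diff_theta:
  assumes "u n = 0" "x \<in> space M"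
  shows "tower_fun n B u v x - tower_fun n B u v (\<theta> x) = tower_fun n B (bdiff u) v x"
proof -
  define g where "g i = (\<Sum>j\<le>n. v j * indicat_real B (act (i, j) x))" for i
  have "act (i, j) (\<theta> x) = act (Suc i, j) x" for i j
    using act_add[of x i 1 j 0] assms(2) by (simp add: act_def)
  then have "tower_fun n B u v (\<theta> x) = (\<Sum>i\<le>n. u i * g (Suc i))"
    by (simp add: tower_fun_def g_def sum_distrib_left mult.assoc del: sum_mult_indicator)
  moreover have "tower_fun n B w v x = (\<Sum>i\<le>n. w i * g i)" for w
    by (simp add: tower_fun_def g_def sum_distrib_left mult.assoc del: sum_mult_indicator)
  ultimately show ?thesis
    using sum_bdiff[of u n g] assms(1) by simp
qed

lemma tower_fun_diff_tau:
  assumes "v n = 0" "x \<in> space M"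
  shows "tower_fun n B u v x - tower_fun n B u v (\<tau> x) = tower_fun n B u (bdiff v) x"
proof -
  define g where "g j = (\<Sum>i\<le>n. u i * indicat_real B (act (i, j) x))" for j
  have "act (i, j) (\<tau> x) = act (i, Suc j) x" for i j
    using act_add[of x i 0 j 1] assms(2) by (simp add: act_def)
  then have "tower_fun n B u v (\<tau> x) = (\<Sum>j\<le>n. v j * g (Suc j))"
    unfolding tower_fun_def g_def
    by (subst sum.swap) (simp add: sum_distrib_left mult_ac del: sum_mult_indicator sum_indicator_mult)
  moreover have "tower_fun n B u w x = (\<Sum>j\<le>n. w j * g j)" for w
    unfolding tower_fun_def g_def
    by (subst sum.swap) (simp add: sum_distrib_left mult_ac del: sum_mult_indicator sum_indicator_mult)
  ultimately show ?thesis
    using sum_bdiff[of v n g] assms(1) by simp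
qed

text \<open>Disjointness of the levels kills the cross terms, invariance gives every level the
  measure of \<open>B\<close>, and the sum of the squared coefficients factors.\<close>

lemma integral_tower_fun_square:
  assumes B [measurable]: "B \<in> sets M"
    and disj: "\<And>p q x. \<lbrakk>p \<in> {..n} \<times> {..n}; q \<in> {..n} \<times> {..n}; p \<noteq> q; x \<in> space M\<rbrakk>
           \<Longrightarrow> \<not> (act p x \<in> B \<and> act q x \<in> B)"
  shows "(\<integral>x. (tower_fun n B u v x)\<^sup>2 \<partial>M) = prob B * (\<Sum>i\<le>n. (u i)\<^sup>2) * (\<Sum>j\<le>n. (v j)\<^sup>2)"
proof -
  define c where "c p = u (fst p) * v (snd p)" for p
  let ?P = "{..n} \<times> {..n}"
  have ind: "(\<integral>x. indicat_real B (act p x) \<partial>M) = prob B" for p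
  proof -
    have "prob B = (\<integral>x. indicat_real B x \<partial>distr M M (act p))"
      by (simp add: distr_act)
    also have "\<dots> = (\<integral>x. indicat_real B (act p x) \<partial>M)"
      by (rule integral_distr) measurable
    finally show ?thesis by simp
  qed
  have int: "integrable M (\<lambda>x. indicat_real B (act p x))" for p
    by (rule integrable_const_bound[where B = 1]) auto
  have "(\<integral>x. (tower_fun n B u v x)\<^sup>2 \<partial>M) = (\<integral>x. (\<Sum>p\<in>?P. (c p)\<^sup>2 * indicat_real B (act p x)) \<partial>M)"
  proof (rule Bochner_Integration.integral_cong)
    fix x assume x: "x \<in> space M"
    have "tower_fun n B u v x = (\<Sum>p\<in>?P. c p * indicat_real B (act p x))"
      by (simp add: tower_fun_def c_def sum.cartesian_product case_prod_unfold
          del: sum_mult_indicator)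
    moreover have "(\<Sum>p\<in>?P. c p * indicat_real B (act p x))\<^sup>2
        = (\<Sum>p\<in>?P. (c p)\<^sup>2 * indicat_real B (act p x))"
    proof (rule square_sum_disjoint)
      show "indicat_real B (act p x) * indicat_real B (act q x) = 0"
        if "p \<in> ?P" "q \<in> ?P" "p \<noteq> q" for p q
        using disj[OF that x] by (auto simp: indicator_def)
    qed (auto simp: indicator_def)
    ultimately show "(tower_fun n B u v x)\<^sup>2 = (\<Sum>p\<in>?P. (c p)\<^sup>2 * indicat_real B (act p x))"
      by (simp only:)
  qed simp
  also have "\<dots> = (\<Sum>p\<in>?P. (c p)\<^sup>2 * prob B)"
    using int by (subst Bochner_Integration.integral_sum) (auto simp: ind)
  also have "\<dots> = prob B * (\<Sum>i\<le>n. (u i)\<^sup>2) * (\<Sum>j\<le>n. (v j)\<^sup>2)"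
  proof -
    have "(\<Sum>p\<in>?P. (c p)\<^sup>2) = (\<Sum>i\<le>n. (u i)\<^sup>2) * (\<Sum>j\<le>n. (v j)\<^sup>2)"
      by (simp add: c_def power_mult_distrib sum_product sum.cartesian_product case_prod_unfold)
    then show ?thesis
      unfolding sum_distrib_right[symmetric] by (simp only: mult_ac)
  qed
  finally show ?thesis .
qed

section \<open>Free orbits almost everywhere\<close>

lemma act_eq_imp_fixed:
  assumes th: "bij_betw \<theta> (space M) (space M)" and ta: "bij_betw \<tau> (space M) (space M)"
    and x: "x \<in> space M" and eq: "act (i, j) x = act (i + d, j') x" and ne: "d \<noteq> 0 \<or> j \<noteq> j'"
  shows "\<exists>a b. (a, b) \<noteq> (0, 0) \<and> int_iterate M \<theta> a (int_iterate M \<tau> b x) = x"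
proof -
  have inj_th: "inj_on (\<theta> ^^ n) (space M)" and inj_ta: "inj_on (\<tau> ^^ n) (space M)" for n
    using bij_betw_funpow[OF th] bij_betw_funpow[OF ta] by (auto simp: bij_betw_def)
  have "(\<theta> ^^ i) ((\<tau> ^^ j) x) = (\<theta> ^^ i) ((\<theta> ^^ d) ((\<tau> ^^ j') x))"
    using eq by (simp add: act_def funpow_add)
  then have eq1: "(\<tau> ^^ j) x = (\<theta> ^^ d) ((\<tau> ^^ j') x)"
    using inj_th[of i] x by (auto dest: inj_onD)
  show ?thesis
  \<comment> \<open>The sign of \<open>j' - j\<close> is that of the second exponent in the
    fixed-point relation; only a negative one involves the inverse of \<open>\<tau>\<close>.\<close>
  proof (cases "j \<le> j'")
    case True
    then obtain e where e: "j' = j + e" by (auto simp: le_iff_add)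
    have "(\<tau> ^^ j) x = (\<tau> ^^ j) ((\<theta> ^^ d) ((\<tau> ^^ e) x))"
      using eq1 x by (simp add: e funpow_add funpow_commute)
    then have "x = (\<theta> ^^ d) ((\<tau> ^^ e) x)"
      using inj_ta[of j] x by (auto dest: inj_onD)
    then show ?thesis
      using ne e by (intro exI[of _ "int d"] exI[of _ "int e"]) (auto simp: int_iterate_def)
  next
    case False
    then obtain e where e: "j = j' + e" "e > 0"
      by (metis less_imp_add_positive not_le)
    have "(\<tau> ^^ j') ((\<tau> ^^ e) x) = (\<tau> ^^ j') ((\<theta> ^^ d) x)"
      using eq1 x by (simp add: e funpow_add funpow_commute)
    then have eq2: "(\<tau> ^^ e) x = (\<theta> ^^ d) x"
      using inj_ta[of j'] x by (auto dest: inj_onD)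
    define \<tau>' where "\<tau>' = inv_into (space M) \<tau>"
    have \<tau>': "\<tau>' z \<in> space M" "\<tau> (\<tau>' z) = z" if "z \<in> space M" for z
      using ta that bij_betw_inv_into_right[OF ta] bij_betwE[OF bij_betw_inv_into[OF ta]]
      by (auto simp: \<tau>'_def)
    have sp: "(\<tau>' ^^ n) x \<in> space M" for n
      using x by (induction n) (auto simp: \<tau>')
    have inv: "(\<tau> ^^ n) ((\<tau>' ^^ n) x) = x" for n
    proof (induction n)
      case (Suc n)
      have "(\<tau> ^^ Suc n) ((\<tau>' ^^ Suc n) x) = (\<tau> ^^ n) (\<tau> (\<tau>' ((\<tau>' ^^ n) x)))"
        by (simp add: funpow_swap1)
      with Suc show ?case by (simp add: \<tau>' sp)
    qed simp
    \<comment> \<open>Rewriting \<open>eq2\<close> in terms of \<open>y\<close> and cancelling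
      \<open>\<tau> ^^ e\<close> will give \<open>(\<theta> ^^ d) y = x\<close>.\<close>
    define y where "y = (\<tau>' ^^ e) x"
    have y: "y \<in> space M" "(\<tau> ^^ e) y = x"
      using sp inv by (auto simp: y_def)
    have "(\<tau> ^^ e) ((\<tau> ^^ e) y) = (\<tau> ^^ e) ((\<theta> ^^ d) y)"
      using eq2 y by (simp flip: funpow_commute)
    then have "(\<theta> ^^ d) y = x"
      using inj_ta[of e] y by (auto dest: inj_onD)
    then show ?thesis
      using e(2) by (intro exI[of _ "int d"] exI[of _ "- int e"])
        (auto simp: int_iterate_def y_def \<tau>'_def)
  qed
qed

text \<open>There are countably many exponent pairs, so one null set excludes all nontrivial
  fixed-point relations at once, and a collision of two orbit points would produce such a
  relation.\<close>

lemma AE_inj_act: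
  assumes th: "bij_betw \<theta> (space M) (space M)" and ta: "bij_betw \<tau> (space M) (space M)"
    and "aperiodic_action M \<theta> \<tau>"
  shows "AE x in M. inj (\<lambda>p. act p x)"
proof -
  have "AE x in M. (a, b) \<noteq> (0, 0) \<longrightarrow> int_iterate M \<theta> a (int_iterate M \<tau> b x) \<noteq> x" for a b
  proof (cases "(a, b) = (0, 0)")
    case False
    then have "{x \<in> space M. int_iterate M \<theta> a (int_iterate M \<tau> b x) = x} \<in> null_sets (completion M)"
      using assms(3) by (auto simp: aperiodic_action_def)
    from AE_not_in[OF this] AE_space[of "completion M"]
    have "AE x in completion M. int_iterate M \<theta> a (int_iterate M \<tau> b x) \<noteq> x"
      by eventually_elim auto
    then show ?thesis
      by (simp add: AE_completion_iff)
  qed simp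
  then have "AE x in M. \<forall>a b. (a, b) \<noteq> (0, 0) \<longrightarrow> int_iterate M \<theta> a (int_iterate M \<tau> b x) \<noteq> x"
    unfolding AE_all_countable by blast
  then show ?thesis
    using AE_space
  proof eventually_elim
    case (elim x)
    have False if "act p x = act q x" "p \<noteq> q" "fst p \<le> fst q" for p q
    proof -
      obtain d where "fst q = fst p + d"
        using \<open>fst p \<le> fst q\<close> by (auto simp: le_iff_add)
      with that show False
        using act_eq_imp_fixed[OF th ta elim(2), of "fst p" "snd p" d "snd q"] elim(1)
        by (cases p; cases q) auto
    qed
    then show ?case
      by (intro injI) (metis nat_le_linear)
  qed
qed

section \<open>Almost invariant mixed differences\<close>

lemma exists_almost_invariant:
  fixes e :: "'a \<Rightarrow> real"
  assumes e: "e \<in> borel_measurable M" "AE x in M. inj (\<lambda>p. e (act p x))"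
    and eps: "0 < \<epsilon>"
  shows "\<exists>\<psi> K. \<psi> \<in> borel_measurable M \<and> (\<forall>x. \<bar>\<psi> x\<bar> \<le> K)
    \<and> (\<integral>x. (mixed_diff \<psi> x)\<^sup>2 \<partial>M) = 1
    \<and> (\<integral>x. (mixed_diff \<psi> x - mixed_diff \<psi> (\<theta> x))\<^sup>2 \<partial>M) \<le> \<epsilon>
    \<and> (\<integral>x. (mixed_diff \<psi> x - mixed_diff \<psi> (\<tau> x))\<^sup>2 \<partial>M) \<le> \<epsilon>"
proof -
  \<comment> \<open>With \<open>n = 2 * m\<close> the two square norms to be made small equal
    \<open>6 / n = 3 / m\<close>.\<close>
  obtain m :: nat where m: "3 / \<epsilon> < m"
    using reals_Archimedean2 by blast
  have m0: "m > 0"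
    using m eps by (metis divide_pos_pos gr0I less_asym of_nat_0 zero_less_numeral)
  define n where "n = 2 * m"
  have "AE x in M. inj_on (\<lambda>p. e (act p x)) ({..n} \<times> {..n})"
    using e(2) by eventually_elim (auto intro: inj_on_subset)
  from tower_exists[OF e(1) this] obtain B where B [measurable]: "B \<in> sets M" and pos: "prob B > 0"
    and disj: "\<And>p q x. \<lbrakk>p \<in> {..n} \<times> {..n}; q \<in> {..n} \<times> {..n}; p \<noteq> q; x \<in> space M\<rbrakk>
           \<Longrightarrow> \<not> (act p x \<in> B \<and> act q x \<in> B)"
    by blast
  \<comment> \<open>A difference in one direction acts on one factor of a tower function. Triangles
    in both directions thus give the mixed difference the coefficients \<open>w i * w j\<close>,
    where \<open>w\<close> is 1 or -1 below \<open>n\<close>.\<close>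
  define u where "u = triangle m"
  define w where "w = bdiff u"
  have profile: "u n = 0" "w n = 0" "(\<Sum>i\<le>n. (w i)\<^sup>2) = real n" "(\<Sum>i\<le>n. (bdiff w i)\<^sup>2) = 6"
    unfolding u_def w_def n_def
    using m0 sum_bdiff_triangle_square[OF m0] sum_bdiff_bdiff_triangle_square[OF m0]
    by (simp_all add: triangle_end bdiff_triangle[of m "2 * m"])
  \<comment> \<open>The square of \<open>tower_fun n B w w\<close> has integral
    \<open>prob B * n * n\<close>, so this factor normalizes the mixed difference to norm 1.\<close>
  define c where "c = 1 / (n * sqrt (prob B))"
  define \<psi> where "\<psi> x = c * tower_fun n B u u x" for x
  have c2: "c\<^sup>2 * prob B = 1 / (n * n)"
    using pos m0 by (simp add: c_def n_def power_divide power_mult_distrib) (simp add: power2_eq_square)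
  have f: "mixed_diff \<psi> x = c * tower_fun n B w w x" if x: "x \<in> space M" for x
  proof -
    have "mixed_diff \<psi> x = c * ((tower_fun n B u u x - tower_fun n B u u (\<theta> x))
        - (tower_fun n B u u (\<tau> x) - tower_fun n B u u (\<theta> (\<tau> x))))"
      by (simp add: mixed_diff_def \<psi>_def algebra_simps)
    also have "\<dots> = c * (tower_fun n B w u x - tower_fun n B w u (\<tau> x))"
      using x profile(1) by (simp add: tower_fun_diff_theta w_def)
    also have "\<dots> = c * tower_fun n B w w x"
      using x profile(1) by (simp add: tower_fun_diff_tau w_def)
    finally show ?thesis .
  qed
  have norm: "(\<integral>x. (c * tower_fun n B v v' x)\<^sup>2 \<partial>M)
      = (\<Sum>i\<le>n. (v i)\<^sup>2) * (\<Sum>j\<le>n. (v' j)\<^sup>2) / (n * n)" for v v'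
    using integral_tower_fun_square[OF B disj, where u = v and v = v'] c2
    by (simp add: power_mult_distrib mult.assoc[symmetric])
  have "(\<integral>x. (mixed_diff \<psi> x)\<^sup>2 \<partial>M) = (\<integral>x. (c * tower_fun n B w w x)\<^sup>2 \<partial>M)"
    by (rule Bochner_Integration.integral_cong) (auto simp: f)
  also have "\<dots> = 1"
    unfolding norm profile using m0 by (simp add: n_def)
  finally have f1: "(\<integral>x. (mixed_diff \<psi> x)\<^sup>2 \<partial>M) = 1" .
  have small: "6 * real n / (n * n) \<le> \<epsilon>"
    using m m0 eps by (simp add: n_def field_simps)
  have "(\<integral>x. (mixed_diff \<psi> x - mixed_diff \<psi> (\<theta> x))\<^sup>2 \<partial>M)
      = (\<integral>x. (c * tower_fun n B (bdiff w) w x)\<^sup>2 \<partial>M)"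
    using profile(2)
    by (intro Bochner_Integration.integral_cong) (auto simp: f tower_fun_diff_theta simp flip: right_diff_distrib)
  also have "\<dots> \<le> \<epsilon>"
    unfolding norm profile using small by (simp add: n_def)
  finally have f2: "(\<integral>x. (mixed_diff \<psi> x - mixed_diff \<psi> (\<theta> x))\<^sup>2 \<partial>M) \<le> \<epsilon>" .
  have "(\<integral>x. (mixed_diff \<psi> x - mixed_diff \<psi> (\<tau> x))\<^sup>2 \<partial>M)
      = (\<integral>x. (c * tower_fun n B w (bdiff w) x)\<^sup>2 \<partial>M)"
    using profile(2)
    by (intro Bochner_Integration.integral_cong) (auto simp: f tower_fun_diff_tau simp flip: right_diff_distrib)
  also have "\<dots> \<le> \<epsilon>"
    unfolding norm profile using small by (simp add: n_def mult.commute)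
  finally have f3: "(\<integral>x. (mixed_diff \<psi> x - mixed_diff \<psi> (\<tau> x))\<^sup>2 \<partial>M) \<le> \<epsilon>" .
  have "\<forall>x. \<bar>\<psi> x\<bar> \<le> \<bar>c\<bar> * (\<Sum>i\<le>n. \<Sum>j\<le>n. \<bar>u i * u j\<bar>)"
    unfolding \<psi>_def abs_mult[of c] by (intro allI mult_left_mono abs_tower_fun_le) auto
  moreover have "\<psi> \<in> borel_measurable M"
    unfolding \<psi>_def by measurable
  ultimately show ?thesis
    using f1 f2 f3 by blast
qed

section \<open>Invariance of integrals and the adjoint of the mixed difference\<close>

lemma measurable_mixed_diff [measurable]:
  assumes [measurable]: "f \<in> borel_measurable M"
  shows "mixed_diff f \<in> borel_measurable M"
  unfolding mixed_diff_def by measurable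

lemma integral_theta: "f \<in> borel_measurable M \<Longrightarrow> (\<integral>x. f (\<theta> x) \<partial>M) = (\<integral>x. (f x :: real) \<partial>M)"
  using integral_distr[OF measurable_theta, of f] by (simp add: distr_theta)

lemma integral_tau: "f \<in> borel_measurable M \<Longrightarrow> (\<integral>x. f (\<tau> x) \<partial>M) = (\<integral>x. (f x :: real) \<partial>M)"
  using integral_distr[OF measurable_tau, of f] by (simp add: distr_tau)

lemma integrable_theta: "integrable M (f :: 'a \<Rightarrow> real) \<Longrightarrow> integrable M (\<lambda>x. f (\<theta> x))"
  using integrable_distr[OF measurable_theta, of f] by (simp add: distr_theta)

lemma integrable_tau: "integrable M (f :: 'a \<Rightarrow> real) \<Longrightarrow> integrable M (\<lambda>x. f (\<tau> x))"
  using integrable_distr[OF measurable_tau, of f] by (simp add: distr_tau)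

lemma abs_mixed_diff_le:
  assumes "\<And>x. \<bar>f x\<bar> \<le> K"
  shows "\<bar>mixed_diff f x\<bar> \<le> 4 * K"
  using assms[of x] assms[of "\<theta> x"] assms[of "\<tau> x"] assms[of "\<theta> (\<tau> x)"]
  by (simp add: mixed_diff_def)

text \<open>
  The adjoint of \<open>(I - U) (I - V)\<close>, applied to \<open>U V \<psi>\<close>, gives
  \<open>(I - U) (I - V) \<psi>\<close> again, so no inverse transformation is needed.
\<close>

lemma integral_mixed_diff:
  assumes h: "integrable M h"
    and \<psi> [measurable]: "\<psi> \<in> borel_measurable M" and K: "\<And>x. \<bar>\<psi> x\<bar> \<le> K"
  shows "(\<integral>x. mixed_diff h x * \<psi> (\<theta> (\<tau> x)) \<partial>M) = (\<integral>x. h x * mixed_diff \<psi> x \<partial>M)"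
proof -
  have [measurable]: "h \<in> borel_measurable M" using h by measurable
  have i0: "integrable M (\<lambda>x. h x * \<psi> x)" "integrable M (\<lambda>x. h x * \<psi> (\<theta> x))"
    "integrable M (\<lambda>x. h x * \<psi> (\<tau> x))" "integrable M (\<lambda>x. h x * \<psi> (\<theta> (\<tau> x)))"
    by (rule integrable_mult_bounded[OF h _ K], measurable)+
  have i1: "integrable M (\<lambda>x. h (\<theta> x) * \<psi> (\<tau> (\<theta> x)))"
    using integrable_theta[OF i0(3)] .
  have i2: "integrable M (\<lambda>x. h (\<tau> x) * \<psi> (\<theta> (\<tau> x)))"
    using integrable_tau[OF i0(2)] .
  have i3: "integrable M (\<lambda>x. h (\<theta> (\<tau> x)) * \<psi> (\<theta> (\<tau> x)))"
    using integrable_tau[OF integrable_theta[OF i0(1)]] .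
  \<comment> \<open>Commutation lets the second term be read as a function of
    \<open>\<theta> x\<close>, so that invariance under \<open>\<theta>\<close> applies to
    it.\<close>
  have "(\<integral>x. mixed_diff h x * \<psi> (\<theta> (\<tau> x)) \<partial>M)
      = (\<integral>x. h x * \<psi> (\<theta> (\<tau> x)) - h (\<theta> x) * \<psi> (\<tau> (\<theta> x))
          - h (\<tau> x) * \<psi> (\<theta> (\<tau> x)) + h (\<theta> (\<tau> x)) * \<psi> (\<theta> (\<tau> x)) \<partial>M)"
    by (rule Bochner_Integration.integral_cong) (auto simp: mixed_diff_def algebra_simps commute)
  also have "\<dots> = (\<integral>x. h x * \<psi> (\<theta> (\<tau> x)) \<partial>M) - (\<integral>x. h (\<theta> x) * \<psi> (\<tau> (\<theta> x)) \<partial>M)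
      - (\<integral>x. h (\<tau> x) * \<psi> (\<theta> (\<tau> x)) \<partial>M) + (\<integral>x. h (\<theta> (\<tau> x)) * \<psi> (\<theta> (\<tau> x)) \<partial>M)"
    using i0 i1 i2 i3 by simp
  also have "(\<integral>x. h (\<theta> x) * \<psi> (\<tau> (\<theta> x)) \<partial>M) = (\<integral>x. h x * \<psi> (\<tau> x) \<partial>M)"
    by (rule integral_theta[of "\<lambda>x. h x * \<psi> (\<tau> x)"]) measurable
  also have "(\<integral>x. h (\<tau> x) * \<psi> (\<theta> (\<tau> x)) \<partial>M) = (\<integral>x. h x * \<psi> (\<theta> x) \<partial>M)"
    by (rule integral_tau[of "\<lambda>x. h x * \<psi> (\<theta> x)"]) measurable
  also have "(\<integral>x. h (\<theta> (\<tau> x)) * \<psi> (\<theta> (\<tau> x)) \<partial>M) = (\<integral>x. h (\<theta> x) * \<psi> (\<theta> x) \<partial>M)"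
    by (rule integral_tau[of "\<lambda>x. h (\<theta> x) * \<psi> (\<theta> x)"]) measurable
  also have "\<dots> = (\<integral>x. h x * \<psi> x \<partial>M)"
    by (rule integral_theta[of "\<lambda>x. h x * \<psi> x"]) measurable
  also have "(\<integral>x. h x * \<psi> (\<theta> (\<tau> x)) \<partial>M) - (\<integral>x. h x * \<psi> (\<tau> x) \<partial>M)
      - (\<integral>x. h x * \<psi> (\<theta> x) \<partial>M) + (\<integral>x. h x * \<psi> x \<partial>M)
      = (\<integral>x. h x * \<psi> (\<theta> (\<tau> x)) - h x * \<psi> (\<tau> x) - h x * \<psi> (\<theta> x) + h x * \<psi> x \<partial>M)"
    using i0 by simp
  also have "\<dots> = (\<integral>x. h x * mixed_diff \<psi> x \<partial>M)"
    by (rule Bochner_Integration.integral_cong) (auto simp: mixed_diff_def algebra_simps)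
  finally show ?thesis .
qed

lemma L2_theta: "f \<in> L2 M \<Longrightarrow> (\<lambda>x. (f (\<theta> x) :: real)) \<in> L2 M"
  using integrable_theta[of "\<lambda>x. (f x)\<^sup>2"] by (auto simp: L2_def)

section \<open>The gliding hump\<close>

text \<open>
  The factor \<open>(K n)\<^sup>2\<close> makes \<open>f\<^sub>k\<close> invisible to the test functions \<open>\<psi>\<^sub>n\<close> with
  \<open>n < k\<close>. The rate 144 is \<open>3\<^sup>2 * 16\<close>: after scaling by \<open>3^k\<close> it leaves the
  rate 16 of \<open>L2_series\<close>.
\<close>

lemma almost_invariant_sequence:
  fixes e :: "'a \<Rightarrow> real"
  assumes e: "e \<in> borel_measurable M" "AE x in M. inj (\<lambda>p. e (act p x))"
  shows "\<exists>(\<psi> :: nat \<Rightarrow> 'a \<Rightarrow> real) (K :: nat \<Rightarrow> real).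
    (\<forall>k. \<psi> k \<in> borel_measurable M) \<and> (\<forall>k x. \<bar>\<psi> k x\<bar> \<le> K k) \<and> (\<forall>k. 1 \<le> K k) \<and>
    (\<forall>k. (\<integral>x. (mixed_diff (\<psi> k) x)\<^sup>2 \<partial>M) = 1) \<and>
    (\<forall>k. (\<integral>x. (mixed_diff (\<psi> k) x - mixed_diff (\<psi> k) (\<theta> x))\<^sup>2 \<partial>M) \<le> (1/144) ^ k) \<and>
    (\<forall>k. (\<integral>x. (mixed_diff (\<psi> k) x - mixed_diff (\<psi> k) (\<tau> x))\<^sup>2 \<partial>M) \<le> (1/144) ^ k) \<and>
    (\<forall>n k. n < k \<longrightarrow>
      (K n)\<^sup>2 * (\<integral>x. (mixed_diff (\<psi> k) x - mixed_diff (\<psi> k) (\<tau> x))\<^sup>2 \<partial>M) \<le> (1/144) ^ k)"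
proof -
  define good where "good \<epsilon> s \<longleftrightarrow> fst s \<in> borel_measurable M \<and> (\<forall>x. \<bar>fst s x\<bar> \<le> snd s) \<and> 1 \<le> snd s
    \<and> (\<integral>x. (mixed_diff (fst s) x)\<^sup>2 \<partial>M) = 1
    \<and> (\<integral>x. (mixed_diff (fst s) x - mixed_diff (fst s) (\<theta> x))\<^sup>2 \<partial>M) \<le> \<epsilon>
    \<and> (\<integral>x. (mixed_diff (fst s) x - mixed_diff (fst s) (\<tau> x))\<^sup>2 \<partial>M) \<le> \<epsilon>"
    for \<epsilon> and s :: "('a \<Rightarrow> real) \<times> real"
  have ex: "\<exists>s. good \<epsilon> s \<and> L \<le> snd s" if "0 < \<epsilon>" for \<epsilon> L
  proof -
    from exists_almost_invariant[OF e that] obtain \<psi> K where \<psi>: "\<psi> \<in> borel_measurable M" "\<forall>x. \<bar>\<psi> x\<bar> \<le> K"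
      "(\<integral>x. (mixed_diff \<psi> x)\<^sup>2 \<partial>M) = 1"
      "(\<integral>x. (mixed_diff \<psi> x - mixed_diff \<psi> (\<theta> x))\<^sup>2 \<partial>M) \<le> \<epsilon>"
      "(\<integral>x. (mixed_diff \<psi> x - mixed_diff \<psi> (\<tau> x))\<^sup>2 \<partial>M) \<le> \<epsilon>"
      by blast
    \<comment> \<open>A bound may be raised freely; taking it at least \<open>L\<close> lets the
      bounds increase along the recursion below.\<close>
    have "\<forall>x. \<bar>\<psi> x\<bar> \<le> max K (max 1 L)"
      using \<psi>(2) by (auto intro: le_max_iff_disj[THEN iffD2])
    then show ?thesis
      using \<psi> by (intro exI[of _ "(\<psi>, max K (max 1 L))"]) (auto simp: good_def)
  qed
  \<comment> \<open>Each choice sees only its predecessor. Keeping the bounds increasing extends the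
    product estimate from consecutive indices to all \<open>n < k\<close>.\<close>
  have "\<exists>s. \<forall>k. good ((1/144) ^ k) (s k) \<and> (snd (s k) \<le> snd (s (Suc k)) \<and>
      (snd (s k))\<^sup>2 * (\<integral>x. (mixed_diff (fst (s (Suc k))) x - mixed_diff (fst (s (Suc k))) (\<tau> x))\<^sup>2 \<partial>M)
        \<le> (1/144) ^ Suc k)"
  proof (rule dependent_nat_choice)
    show "\<exists>s. good ((1/144) ^ 0) s"
      using ex[of 1 0] by (auto simp del: split_paired_Ex)
    fix s :: "('a \<Rightarrow> real) \<times> real" and k
    assume s: "good ((1/144) ^ k) s"
    \<comment> \<open>Dividing by the squared bound of the predecessor gives the product estimate;
      as that bound is at least 1, the plain rate follows too.\<close>
    define \<epsilon> :: real where "\<epsilon> = (1/144) ^ Suc k / (snd s)\<^sup>2"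
    have s1: "1 \<le> (snd s)\<^sup>2"
      using s by (simp add: good_def one_le_power)
    then have eps: "0 < \<epsilon>" "(snd s)\<^sup>2 * \<epsilon> = (1/144) ^ Suc k"
      by (auto simp: \<epsilon>_def intro!: divide_pos_pos)
    have le: "\<epsilon> \<le> (1/144) ^ Suc k"
      using mult_right_mono[OF s1, of \<epsilon>] eps by simp
    from ex[OF eps(1), of "snd s"] obtain t where t: "good \<epsilon> t" "snd s \<le> snd t"
      by blast
    have "(snd s)\<^sup>2 * (\<integral>x. (mixed_diff (fst t) x - mixed_diff (fst t) (\<tau> x))\<^sup>2 \<partial>M) \<le> (snd s)\<^sup>2 * \<epsilon>"
      using t(1) by (intro mult_left_mono) (auto simp: good_def)
    moreover have "good ((1/144) ^ Suc k) t"
      using t(1) le unfolding good_def by (meson order.trans)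
    ultimately show "\<exists>t. good ((1/144) ^ Suc k) t \<and> (snd s \<le> snd t \<and>
      (snd s)\<^sup>2 * (\<integral>x. (mixed_diff (fst t) x - mixed_diff (fst t) (\<tau> x))\<^sup>2 \<partial>M) \<le> (1/144) ^ Suc k)"
      using t(2) unfolding eps(2) by blast
  qed
  then obtain s where s: "\<And>k. good ((1/144) ^ k) (s k)" "\<And>k. snd (s k) \<le> snd (s (Suc k))"
    "\<And>k. (snd (s k))\<^sup>2 * (\<integral>x. (mixed_diff (fst (s (Suc k))) x - mixed_diff (fst (s (Suc k))) (\<tau> x))\<^sup>2 \<partial>M)
        \<le> (1/144) ^ Suc k"
    by blast
  have last: "(snd (s n))\<^sup>2 * (\<integral>x. (mixed_diff (fst (s k)) x - mixed_diff (fst (s k)) (\<tau> x))\<^sup>2 \<partial>M) \<le> (1/144) ^ k"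
    if "n < k" for n k
  proof -
    obtain l where l: "k = Suc l" "n \<le> l"
      using \<open>n < k\<close> by (cases k) auto
    have "snd (s n) \<le> snd (s l)"
      using lift_Suc_mono_le[of "\<lambda>k. snd (s k)"] s(2) l(2) by blast
    moreover have "1 \<le> snd (s n)"
      using s(1)[of n] by (simp add: good_def)
    ultimately have "(snd (s n))\<^sup>2 \<le> (snd (s l))\<^sup>2"
      by (intro power_mono) auto
    then have "(snd (s n))\<^sup>2 * (\<integral>x. (mixed_diff (fst (s k)) x - mixed_diff (fst (s k)) (\<tau> x))\<^sup>2 \<partial>M)
      \<le> (snd (s l))\<^sup>2 * (\<integral>x. (mixed_diff (fst (s k)) x - mixed_diff (fst (s k)) (\<tau> x))\<^sup>2 \<partial>M)"
      by (intro mult_right_mono) auto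
    with s(3)[of l] show ?thesis
      by (simp add: l)
  qed
  show ?thesis
    by (rule exI[of _ "\<lambda>k. fst (s k)"], rule exI[of _ "\<lambda>k. snd (s k)"])
       (use s(1) last in \<open>auto simp: good_def\<close>)
qed

lemma exists_not_mixed_coboundary:
  fixes e :: "'a \<Rightarrow> real"
  assumes e: "e \<in> borel_measurable M" "AE x in M. inj (\<lambda>p. e (act p x))"
  shows "\<exists>g :: 'a \<Rightarrow> real.
    g \<in> L2_range M (id_minus (koopman \<theta>)) \<inter> L2_range M (id_minus (koopman \<tau>)) \<and>
    g \<notin> L2_range M (id_minus (koopman \<theta>) \<circ> id_minus (koopman \<tau>))"
proof -
  from almost_invariant_sequence[OF e] obtain \<psi> :: "nat \<Rightarrow> 'a \<Rightarrow> real" and K :: "nat \<Rightarrow> real"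
  where \<psi> [measurable]: "\<And>k. \<psi> k \<in> borel_measurable M"
    and K: "\<And>k x. \<bar>\<psi> k x\<bar> \<le> K k" "\<And>k. 1 \<le> K k"
    and norm_f: "\<And>k. (\<integral>x. (mixed_diff (\<psi> k) x)\<^sup>2 \<partial>M) = 1"
    and a: "\<And>k. (\<integral>x. (mixed_diff (\<psi> k) x - mixed_diff (\<psi> k) (\<theta> x))\<^sup>2 \<partial>M) \<le> (1/144) ^ k"
    and b: "\<And>k. (\<integral>x. (mixed_diff (\<psi> k) x - mixed_diff (\<psi> k) (\<tau> x))\<^sup>2 \<partial>M) \<le> (1/144) ^ k"
    and Kb: "\<And>n k. n < k \<Longrightarrow>
      (K n)\<^sup>2 * (\<integral>x. (mixed_diff (\<psi> k) x - mixed_diff (\<psi> k) (\<tau> x))\<^sup>2 \<partial>M) \<le> (1/144) ^ k"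
    by blast
  define f where "f k = mixed_diff (\<psi> k)" for k
  \<comment> \<open>The sums of \<open>y\<close> and \<open>z\<close> will be the preimages of
    \<open>g\<close> under \<open>I - U\<close> and \<open>I - V\<close> respectively.\<close>
  define y where "y k x = 3 ^ k * (f k x - f k (\<tau> x))" for k x
  define z where "z k x = 3 ^ k * (f k x - f k (\<theta> x))" for k x
  have [measurable]: "f k \<in> borel_measurable M"
    and y [measurable]: "y k \<in> borel_measurable M" and z [measurable]: "z k \<in> borel_measurable M"
    and yt: "(\<lambda>x. y k (\<theta> x)) \<in> borel_measurable M" for k
    unfolding f_def y_def z_def by measurable
  have f_le: "\<bar>f k x\<bar> \<le> 4 * K k" for k x
    unfolding f_def by (rule abs_mixed_diff_le) (rule K)
  have y_le: "\<bar>y k x\<bar> \<le> 3 ^ k * (8 * K k)" for k x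
    unfolding y_def abs_mult using f_le[of k x] f_le[of k "\<tau> x"] by (intro mult_mono) auto
  have z_le: "\<bar>z k x\<bar> \<le> 3 ^ k * (8 * K k)" for k x
    unfolding z_def abs_mult using f_le[of k x] f_le[of k "\<theta> x"] by (intro mult_mono) auto
  have sq_bound: "integrable M (\<lambda>x. (F x)\<^sup>2)"
    if "F \<in> borel_measurable M" "\<And>x. \<bar>F x\<bar> \<le> L" for F :: "'a \<Rightarrow> real" and L
  proof (rule integrable_bounded)
    show "\<bar>(F x)\<^sup>2\<bar> \<le> L\<^sup>2" for x
      using power_mono[OF that(2), of x 2] by simp
  qed (use that in measurable)
  have f2: "integrable M (\<lambda>x. (f k x)\<^sup>2)" for k
    by (rule sq_bound[OF _ f_le]) measurable
  have y2: "integrable M (\<lambda>x. (y k x)\<^sup>2)" for k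
    by (rule sq_bound[OF _ y_le]) measurable
  have z2: "integrable M (\<lambda>x. (z k x)\<^sup>2)" for k
    by (rule sq_bound[OF _ z_le]) measurable
  have nine: "(9::real) ^ k * (1/144) ^ k = (1/16) ^ k" for k
    by (simp flip: power_mult_distrib)
  have sq3: "((3::real) ^ k * t)\<^sup>2 = 9 ^ k * t\<^sup>2" for k t
    using power_mult_distrib[of "3::real" 3 k] by (simp add: power2_eq_square mult_ac)
  have y16: "(\<integral>x. (y k x)\<^sup>2 \<partial>M) \<le> (1/16) ^ k" for k
    using mult_left_mono[OF b[of k], of "9 ^ k"] by (simp add: y_def f_def sq3 nine)
  have z16: "(\<integral>x. (z k x)\<^sup>2 \<partial>M) \<le> (1/16) ^ k" for k
    using mult_left_mono[OF a[of k], of "9 ^ k"] by (simp add: z_def f_def sq3 nine)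
  note Y = L2_series[of y, OF y y2 y16] and Z = L2_series[of z, OF z z2 z16]
  have yt2: "integrable M (\<lambda>x. (y k (\<theta> x))\<^sup>2)" for k
    using integrable_theta[OF y2] .
  have yt16: "(\<integral>x. (y k (\<theta> x))\<^sup>2 \<partial>M) \<le> (1/16) ^ k" for k
    using integral_theta[of "\<lambda>x. (y k x)\<^sup>2"] y16[of k] by simp
  \<comment> \<open>The series composed with \<open>\<theta>\<close> inherits the norm bounds, so
    \<open>A (\<theta> x)\<close> can be paired termwise as well.\<close>
  note YT = L2_series[of "\<lambda>k x. y k (\<theta> x)", OF yt yt2 yt16]
  define A where "A x = (\<Sum>k. y k x)" for x
  define B where "B x = (\<Sum>k. z k x)" for x
  have A: "A \<in> L2 M" and B: "B \<in> L2 M"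
    using Y(2) Z(2) by (simp_all add: L2_def A_def[abs_def] B_def[abs_def])
  define g where "g x = A x - A (\<theta> x)" for x
  have g: "g \<in> L2 M"
    unfolding g_def[abs_def] by (rule L2_diff[OF A L2_theta[OF A]])
  have yz: "y k x - y k (\<theta> x) = 3 ^ k * mixed_diff (f k) x" "z k x - z k (\<tau> x) = 3 ^ k * mixed_diff (f k) x"
    if "x \<in> space M" for k x
    using commute[OF that] by (simp_all add: y_def z_def mixed_diff_def algebra_simps)
  \<comment> \<open>Both sides expand into the same series of scaled mixed differences wherever the
    four series involved converge.\<close>
  have gB: "AE x in M. g x = B x - B (\<tau> x)"
    using Y(1) YT(1) Z(1) AE_comp[OF measurable_tau distr_tau Z(1)] AE_space
  proof eventually_elim
    case (elim x)
    then have "g x = (\<Sum>k. y k x - y k (\<theta> x))" "B x - B (\<tau> x) = (\<Sum>k. z k x - z k (\<tau> x))"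
      unfolding g_def A_def B_def by (auto intro!: suminf_diff intro: summable_rabs_cancel)
    then show ?case
      using yz[OF elim(5)] by simp
  qed
  have "g \<notin> L2_range M (id_minus (koopman \<theta>) \<circ> id_minus (koopman \<tau>))"
  proof
    assume "g \<in> L2_range M (id_minus (koopman \<theta>) \<circ> id_minus (koopman \<tau>))"
    then obtain h where h: "h \<in> L2 M"
      and gh: "AE x in M. g x = (id_minus (koopman \<theta>) \<circ> id_minus (koopman \<tau>)) h x"
      by (auto simp: L2_range_def)
    have h_meas [measurable]: "h \<in> borel_measurable M" and h2: "integrable M (\<lambda>x. (h x)\<^sup>2)"
      using h by (auto simp: L2_def)
    have g_mixed: "AE x in M. g x = mixed_diff h x"
      using gh AE_space
      by eventually_elim (auto simp: id_minus_def koopman_def mixed_diff_def commute)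
    have [measurable]: "g \<in> borel_measurable M"
      using g by (simp add: L2_def)
    \<comment> \<open>This bounds the pairing of \<open>h\<close> with every function of norm 1,
      independently of \<open>n\<close>.\<close>
    define C where "C = ((\<integral>x. (h x)\<^sup>2 \<partial>M) + 1) / 2"
    have le: "3 ^ n / 2 \<le> C + 8/3" for n
    proof -
      \<comment> \<open>The test function \<open>U V \<psi>\<^sub>n\<close>: pairing a mixed
        difference with it moves the difference onto \<open>\<psi> n\<close>.\<close>
      define \<eta> where "\<eta> x = \<psi> n (\<theta> (\<tau> x))" for x
      have \<eta> [measurable]: "\<eta> \<in> borel_measurable M" and \<eta>K: "\<And>x. \<bar>\<eta> x\<bar> \<le> K n"
        unfolding \<eta>_def by (measurable, rule K)
      have iy: "integrable M (\<lambda>x. y k x * \<eta> x)" "integrable M (\<lambda>x. y k (\<theta> x) * \<eta> x)" for k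
        by (rule integrable_mult_bounded[OF square_integrable_imp_integrable[OF y y2] \<eta> \<eta>K],
            rule integrable_mult_bounded[OF square_integrable_imp_integrable[OF yt yt2] \<eta> \<eta>K])
      define t where "t k = 3 ^ k * (\<integral>x. f k x * f n x \<partial>M)" for k
      have t: "(\<integral>x. y k x * \<eta> x \<partial>M) - (\<integral>x. y k (\<theta> x) * \<eta> x \<partial>M) = t k" for k
      proof -
        have "(\<integral>x. y k x * \<eta> x \<partial>M) - (\<integral>x. y k (\<theta> x) * \<eta> x \<partial>M)
            = (\<integral>x. y k x * \<eta> x - y k (\<theta> x) * \<eta> x \<partial>M)"
          using iy by simp
        also have "\<dots> = (\<integral>x. 3 ^ k * (mixed_diff (f k) x * \<eta> x) \<partial>M)"
          by (rule Bochner_Integration.integral_cong) (auto simp flip: yz(1) simp: algebra_simps)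
        also have "\<dots> = 3 ^ k * (\<integral>x. mixed_diff (f k) x * \<eta> x \<partial>M)"
          by simp
        also have "(\<integral>x. mixed_diff (f k) x * \<eta> x \<partial>M) = (\<integral>x. f k x * f n x \<partial>M)"
          unfolding \<eta>_def f_def[of n]
          by (rule integral_mixed_diff[OF square_integrable_imp_integrable[OF _ f2] \<psi> K(1)]) measurable
        finally show ?thesis
          by (simp add: t_def)
      qed
      have "(\<lambda>k. (\<integral>x. y k x * \<eta> x \<partial>M) - (\<integral>x. y k (\<theta> x) * \<eta> x \<partial>M))
          sums ((\<integral>x. A x * \<eta> x \<partial>M) - (\<integral>x. A (\<theta> x) * \<eta> x \<partial>M))"
        unfolding A_def by (intro sums_diff Y(3)[OF \<eta> \<eta>K] YT(3)[OF \<eta> \<eta>K])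
      moreover have "(\<integral>x. A x * \<eta> x \<partial>M) - (\<integral>x. A (\<theta> x) * \<eta> x \<partial>M) = (\<integral>x. g x * \<eta> x \<partial>M)"
      proof -
        have "A \<in> borel_measurable M" "integrable M (\<lambda>x. (A x)\<^sup>2)"
          using A by (simp_all add: L2_def)
        then have A1: "integrable M A"
          by (rule square_integrable_imp_integrable)
        have "integrable M (\<lambda>x. A x * \<eta> x)" "integrable M (\<lambda>x. A (\<theta> x) * \<eta> x)"
          by (rule integrable_mult_bounded[OF A1 \<eta> \<eta>K],
              rule integrable_mult_bounded[OF integrable_theta[OF A1] \<eta> \<eta>K])
        then have "(\<integral>x. A x * \<eta> x \<partial>M) - (\<integral>x. A (\<theta> x) * \<eta> x \<partial>M)
            = (\<integral>x. A x * \<eta> x - A (\<theta> x) * \<eta> x \<partial>M)"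
          by (rule Bochner_Integration.integral_diff[symmetric])
        then show ?thesis
          by (simp only: g_def left_diff_distrib)
      qed
      ultimately have sums_t: "t sums (\<integral>x. g x * \<eta> x \<partial>M)"
        by (simp add: t)
      have t_n: "t n = 3 ^ n"
        using norm_f[of n] by (simp add: t_def f_def power2_eq_square)
      \<comment> \<open>Norm 1 of both functions suffices before the hump, since the powers of 3
        below \<open>3 ^ n\<close> add up to less than half of it.\<close>
      have t_less: "- (3 ^ k) \<le> t k" for k
      proof -
        have "\<bar>\<integral>x. f k x * f n x \<partial>M\<bar> \<le> 1"
          using integral_mult_le[OF _ _ f2[of k] f2[of n]] norm_f[of k] norm_f[of n] by (simp add: f_def)
        then have "3 ^ k * (-1) \<le> t k"
          unfolding t_def by (intro mult_left_mono) auto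
        then show ?thesis by simp
      qed
      \<comment> \<open>Past the hump, an L1 estimate against the bound \<open>K n\<close> of
        \<open>\<eta>\<close> applies; \<open>y k\<close> and its composition with
        \<open>\<theta>\<close> each cost \<open>(1/4) ^ k\<close>.\<close>
      have t_greater: "- (2 * (1/4) ^ k) \<le> t k" if "n < k" for k
      proof -
        have L1: "(\<integral>x. \<bar>K n * y k x\<bar> \<partial>M) \<le> (1/4) ^ k"
        proof (rule integral_abs_le_of_square)
          have "(\<integral>x. (K n * y k x)\<^sup>2 \<partial>M) = 9 ^ k * ((K n)\<^sup>2 * (\<integral>x. (f k x - f k (\<tau> x))\<^sup>2 \<partial>M))"
            by (simp add: y_def power_mult_distrib[of "K n"] sq3)
          also have "\<dots> \<le> 9 ^ k * (1/144) ^ k"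
            using Kb[OF that] by (intro mult_left_mono) (auto simp: f_def)
          finally show "(\<integral>x. (K n * y k x)\<^sup>2 \<partial>M) \<le> ((1/4) ^ k)\<^sup>2"
            unfolding nine by (simp add: power2_eq_square flip: power_mult_distrib)
          show "integrable M (\<lambda>x. (K n * y k x)\<^sup>2)"
            using y2 by (simp add: power_mult_distrib)
        qed auto
        have K0: "0 \<le> K n"
          using K(2)[of n] by simp
        have i: "integrable M (\<lambda>x. \<bar>K n * y k x\<bar>)"
          using square_integrable_imp_integrable[OF _ y2, of k] by (intro integrable_abs integrable_mult_right) auto
        have pt: "\<bar>v * \<eta> x\<bar> \<le> \<bar>K n * v\<bar>" for v x
          using mult_left_mono[OF \<eta>K[of x], of "\<bar>v\<bar>"] K0 by (simp add: abs_mult mult_ac)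
        have "\<bar>\<integral>x. y k x * \<eta> x \<partial>M\<bar> \<le> (\<integral>x. \<bar>K n * y k x\<bar> \<partial>M)"
          by (rule order.trans[OF integral_abs_bound]) (use pt i iy in \<open>auto intro!: integral_mono\<close>)
        moreover have "\<bar>\<integral>x. y k (\<theta> x) * \<eta> x \<partial>M\<bar> \<le> (\<integral>x. \<bar>K n * y k (\<theta> x)\<bar> \<partial>M)"
          by (rule order.trans[OF integral_abs_bound])
             (use pt integrable_theta[OF i] iy in \<open>auto intro!: integral_mono\<close>)
        moreover have "(\<integral>x. \<bar>K n * y k (\<theta> x)\<bar> \<partial>M) = (\<integral>x. \<bar>K n * y k x\<bar> \<partial>M)"
          by (rule integral_theta[of "\<lambda>x. \<bar>K n * y k x\<bar>"]) measurable
        ultimately show ?thesis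
          using t[of k] L1 by linarith
      qed
      \<comment> \<open>A termwise minorant of \<open>t\<close>. The tail correction is subtracted
        at every index, which makes it a full geometric series with sum 8/3.\<close>
      define s :: "nat \<Rightarrow> real" where "s k = (if k \<le> n then (if k = n then 3 ^ n else - (3 ^ k)) else 0) - 2 * (1/4) ^ k"
        for k
      have "s k \<le> t k" for k
      proof -
        have pos: "0 \<le> (1/4::real) ^ k"
          by simp
        show ?thesis
        proof (cases k n rule: linorder_cases)
          case less
          then have "s k = - (3 ^ k) - 2 * (1/4) ^ k"
            by (simp add: s_def)
          with t_less[of k] pos show ?thesis by linarith
        next
          case equal
          then have "s k = t k - 2 * (1/4) ^ k"
            by (simp add: s_def t_n)
          with pos show ?thesis by linarith
        next
          case greater
          then have "s k = - (2 * (1/4) ^ k)"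
            by (simp add: s_def)
          with t_greater[OF greater] show ?thesis by simp
        qed
      qed
      moreover have "s sums ((\<Sum>k\<le>n. if k = n then 3 ^ n else - (3 ^ k)) - 2 * (4/3))"
      proof -
        have "(\<lambda>k. if k \<le> n then (if k = n then 3 ^ n else - (3 ^ k)) else 0 :: real)
            sums (\<Sum>k\<le>n. if k = n then 3 ^ n else - (3 ^ k))"
          using sums_If_finite_set[of "{..n}" "\<lambda>k. if k = n then 3 ^ n else - (3 ^ k) :: real"] by simp
        moreover have "(\<lambda>k. 2 * (1/4) ^ k :: real) sums (2 * (4/3))"
          using geometric_sums[of "1/4::real"] by (intro sums_mult) simp
        ultimately show ?thesis
          unfolding s_def by (rule sums_diff)
      qed
      ultimately have "(\<Sum>k\<le>n. if k = n then 3 ^ n else - (3 ^ k)) - 2 * (4/3) \<le> (\<integral>x. g x * \<eta> x \<partial>M)"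
        using sums_t by (rule sums_le)
      \<comment> \<open>The earlier terms take away \<open>(3 ^ n - 1) / 2\<close>, so more than
        half of the hump survives.\<close>
      moreover have "(\<Sum>k\<le>n. if k = n then 3 ^ n else - (3 ^ k)) = (3 ^ n + 1) / (2 :: real)"
      proof -
        have "(\<Sum>k\<le>n. if k = n then 3 ^ n else - (3 ^ k)) = 3 ^ n - (\<Sum>k<n. 3 ^ k :: real)"
          by (simp add: sum_negf flip: lessThan_Suc_atMost)
        then show ?thesis
          by (simp add: geometric_sum field_simps)
      qed
      moreover have "(\<integral>x. g x * \<eta> x \<partial>M) \<le> C"
      proof -
        \<comment> \<open>By the assumed representation of \<open>g\<close>, the adjoint identity
          turns this pairing into that of \<open>h\<close> with \<open>f n\<close>.\<close>
        have "(\<integral>x. g x * \<eta> x \<partial>M) = (\<integral>x. mixed_diff h x * \<eta> x \<partial>M)"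
          using g_mixed by (intro integral_cong_AE) auto
        also have "\<dots> = (\<integral>x. h x * f n x \<partial>M)"
          unfolding \<eta>_def f_def
          by (rule integral_mixed_diff[OF square_integrable_imp_integrable[OF _ h2] \<psi> K(1)]) measurable
        also have "\<dots> \<le> C"
          using integral_mult_le[OF h_meas _ h2 f2[of n]] norm_f[of n] by (simp add: C_def f_def)
        finally show ?thesis .
      qed
      ultimately show ?thesis
        by (simp add: field_simps)
    qed
    obtain n :: nat where "2 * (C + 8/3) < 3 ^ n"
      using real_arch_pow[of 3 "2 * (C + 8/3)"] by auto
    with le[of n] show False
      by simp
  qed
  moreover have "g \<in> L2_range M (id_minus (koopman \<theta>))"
    unfolding L2_range_def using g A by (auto simp: id_minus_def koopman_def g_def)
  moreover have "g \<in> L2_range M (id_minus (koopman \<tau>))"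
    unfolding L2_range_def using g B gB by (auto simp: id_minus_def koopman_def)
  ultimately show ?thesis
    by blast
qed

end

section \<open>Conclusion over the real and the complex scalars\<close>

theorem theorem3p6:
  fixes M :: "'a measure" and \<theta> \<tau> :: "'a \<Rightarrow> 'a"
  assumes "standard_prob_space M"
    and "invertible_mpt M \<theta>"
    and "invertible_mpt M \<tau>"
    and "\<And>x. x \<in> space M \<Longrightarrow> \<theta> (\<tau> x) = \<tau> (\<theta> x)"
    and "aperiodic_action M \<theta> \<tau>"
  shows "(\<exists>g :: 'a \<Rightarrow> complex.
            g \<in> L2_range M (id_minus (koopman \<theta>)) \<inter> L2_range M (id_minus (koopman \<tau>)) \<and>
            g \<notin> L2_range M (id_minus (koopman \<theta>) \<circ> id_minus (koopman \<tau>)))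
       \<and> (\<exists>g :: 'a \<Rightarrow> real.
            g \<in> L2_range M (id_minus (koopman \<theta>)) \<inter> L2_range M (id_minus (koopman \<tau>)) \<and>
            g \<notin> L2_range M (id_minus (koopman \<theta>) \<circ> id_minus (koopman \<tau>)))"
proof -
  interpret commuting_mpt M \<theta> \<tau>
    using assms(1-4)
    by (auto simp: commuting_mpt_def commuting_mpt_axioms_def standard_prob_space_def invertible_mpt_def)
  from standard_prob_space_injection[OF assms(1)] obtain e :: "'a \<Rightarrow> real" and A
    where e: "e \<in> borel_measurable M" and A: "AE x in M. x \<in> A" and inj: "inj_on e A"
    by blast
  \<comment> \<open>The orbit of almost every point stays in \<open>A\<close>, because countably
    many preimages of a set of full measure are intersected; there \<open>e\<close> separates
    distinct orbit points.\<close>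
  have "AE x in M. act p x \<in> A" for p
    by (rule AE_comp[OF measurable_act distr_act A])
  then have "AE x in M. \<forall>p. act p x \<in> A"
    by (simp add: AE_all_countable)
  moreover have "AE x in M. inj (\<lambda>p. act p x)"
    using assms(2,3,5) by (intro AE_inj_act) (auto simp: invertible_mpt_def)
  ultimately have "AE x in M. inj (\<lambda>p. e (act p x))"
  proof eventually_elim
    case (elim x)
    then show ?case
      using inj by (auto simp: inj_on_def simp del: split_paired_All)
  qed
  from exists_not_mixed_coboundary[OF e this] obtain g :: "'a \<Rightarrow> real"
    where g: "g \<in> L2_range M (id_minus (koopman \<theta>))" "g \<in> L2_range M (id_minus (koopman \<tau>))"
      "g \<notin> L2_range M (id_minus (koopman \<theta>) \<circ> id_minus (koopman \<tau>))"
    by blast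
  have of_real_range: "(\<lambda>x. complex_of_real (g x)) \<in> L2_range M (id_minus (koopman T))"
    if g_range: "g \<in> L2_range M (id_minus (koopman T))" for T :: "'a \<Rightarrow> 'a"
  proof -
    from g_range obtain f where f: "f \<in> L2 M" "AE x in M. g x = f x - f (T x)" "g \<in> L2 M"
      by (auto simp: L2_range_def id_minus_def koopman_def)
    have "AE x in M. complex_of_real (g x) = complex_of_real (f x) - complex_of_real (f (T x))"
      using f(2) by eventually_elim simp
    then show ?thesis
      using L2_of_real[OF f(1)] L2_of_real[OF f(3)]
      by (auto simp: L2_range_def id_minus_def koopman_def intro!: bexI[of _ "\<lambda>x. complex_of_real (f x)"])
  qed
  \<comment> \<open>The operators commute with taking real parts, so the real part of a complex
    solution \<open>h\<close> would solve the equation for the real \<open>g\<close>.\<close>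
  have "(\<lambda>x. complex_of_real (g x)) \<notin> L2_range M (id_minus (koopman \<theta>) \<circ> id_minus (koopman \<tau>))"
  proof
    assume "(\<lambda>x. complex_of_real (g x)) \<in> L2_range M (id_minus (koopman \<theta>) \<circ> id_minus (koopman \<tau>))"
    then obtain h :: "'a \<Rightarrow> complex" where h: "h \<in> L2 M"
      "AE x in M. complex_of_real (g x) = (id_minus (koopman \<theta>) \<circ> id_minus (koopman \<tau>)) h x"
      by (auto simp: L2_range_def)
    from h(2) have "AE x in M. g x = (id_minus (koopman \<theta>) \<circ> id_minus (koopman \<tau>)) (\<lambda>x. Re (h x)) x"
      by eventually_elim (drule arg_cong[of _ _ Re], simp add: id_minus_def koopman_def)
    with L2_Re[OF h(1)] g(1,3) show False
      by (auto simp: L2_range_def)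
  qed
  with of_real_range g show ?thesis
    by blast
qed

end
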